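(* For every $n\ge 2$, the assignment $G\mapsto A_G^{(n)}$ extends canonically to a covariant functor $\mathcal A_n:\mathbf{Graph}\to\mathbf{GrAlg}_{\mathbb Q}$. More precisely, $G\mapsto (A_G^{(n)}\subseteq H_G^{(n)})$ is a covariant functor to graded $\mathbb Q$-algebras equipped with a distinguished graded subalgebra. Here a graph homomorphism $f:F\to G$ acts by the cohomological pullback $f_{X_n}^*:H_F^{(n)}\to H_G^{(n)}$, restricted to the distinguished subalgebras in the case of $\mathcal A_n$.
   Context: $\mathbf{Graph}$ is the category of finite simple loopless graphs and graph homomorphisms (vertex maps sending edges to edges); $\mathbf{GrAlg}_{\mathbb Q}$ is the category of graded $\mathbb Q$-algebras. For a space $X$ and a graph $G$, $\mathrm{Conf}_G(X)=\{(x_v)_{v\in V(G)}\in X^{V(G)}: x_u\ne x_v \text{ whenever } uv\in E(G)\}$. For $n\ge2$ put $X_n=\mathbb P^{n-1}(\mathbb C)$, whose points are the one-dimensional subspaces $\ell\subset\mathbb C^n$. For a graph homomorphism $f:F\to G$, $f_{X_n}:\mathrm{Conf}_G(X_n)\to\mathrm{Conf}_F(X_n)$ is the map $(x_w)_{w\in V(G)}\mapsto (x_{f(v)})_{v\in V(F)}$. For an edge $e=uv$ of $G$ let $\phi_e^G:\mathrm{Conf}_G(X_n)\to\mathrm{Gr}(2,n)$ be the map $(\ell_w)_w\mapsto\langle\ell_u,\ell_v\rangle$, and let $\mathcal S$ be the tautological rank-two subbundle on $\mathrm{Gr}(2,n)$. Put $a_e^G=(\phi_e^G)^*c_1(\mathcal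 S^* )$ (degree 2) and $b_e^G=(\phi_e^G)^*c_2(\mathcal S^* )$ (degree 4). Let $H_G^{(n)}=H^*(\mathrm{Conf}_G(X_n);\mathbb Q)$, and let the edge-span algebra $A_G^{(n)}\subseteq H_G^{(n)}$ be the unital graded $\mathbb Q$-subalgebra generated by all $a_e^G,b_e^G$, $e\in E(G)$. *)

theory Defs
  imports
    "HOL-Homology.Homology" "HOL-Algebra.QuotRing" "HOL-Algebra.Subrings"
    "HOL-Library.Function_Algebras"
begin

section \<open>Categories and functors\<close>

text \<open>The field \<open>cat_comp C X Y Z g f\<close> is the composite of \<open>f : X \<rightarrow> Y\<close> and \<open>g : Y \<rightarrow> Z\<close>.\<close>

record ('o, 'm) cat =
  cat_ob :: "'o set"
  cat_hom :: "'o \<Rightarrow> 'o \<Rightarrow> 'm set"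
  cat_id :: "'o \<Rightarrow> 'm"
  cat_comp :: "'o \<Rightarrow> 'o \<Rightarrow> 'o \<Rightarrow> 'm \<Rightarrow> 'm \<Rightarrow> 'm"

definition is_category :: "('o, 'm) cat \<Rightarrow> bool" where
  "is_category C \<longleftrightarrow>
     (\<forall>X\<in>cat_ob C. cat_id C X \<in> cat_hom C X X) \<and>
     (\<forall>X\<in>cat_ob C. \<forall>Y\<in>cat_ob C. \<forall>Z\<in>cat_ob C. \<forall>f\<in>cat_hom C X Y. \<forall>g\<in>cat_hom C Y Z.
        cat_comp C X Y Z g f \<in> cat_hom C X Z) \<and>
     (\<forall>X\<in>cat_ob C. \<forall>Y\<in>cat_ob C. \<forall>f\<in>cat_hom C X Y.
        cat_comp C X X Y f (cat_id C X) = f \<and> cat_comp C X Y Y (cat_id C Y) f = f) \<and>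
     (\<forall>X\<in>cat_ob C. \<forall>Y\<in>cat_ob C. \<forall>Z\<in>cat_ob C. \<forall>W\<in>cat_ob C.
        \<forall>f\<in>cat_hom C X Y. \<forall>g\<in>cat_hom C Y Z. \<forall>h\<in>cat_hom C Z W.
        cat_comp C X Z W h (cat_comp C X Y Z g f) = cat_comp C X Y W (cat_comp C Y Z W h g) f)"

definition covariant_functor ::
  "('o, 'm) cat \<Rightarrow> ('p, 'k) cat \<Rightarrow> ('o \<Rightarrow> 'p) \<Rightarrow> ('o \<Rightarrow> 'o \<Rightarrow> 'm \<Rightarrow> 'k) \<Rightarrow> bool" where
  "covariant_functor C D Fo Fm \<longleftrightarrow>
     is_category C \<and> is_category D \<and>
     (\<forall>X\<in>cat_ob C. Fo X \<in> cat_ob D) \<and>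
     (\<forall>X\<in>cat_ob C. \<forall>Y\<in>cat_ob C. \<forall>f\<in>cat_hom C X Y. Fm X Y f \<in> cat_hom D (Fo X) (Fo Y)) \<and>
     (\<forall>X\<in>cat_ob C. Fm X X (cat_id C X) = cat_id D (Fo X)) \<and>
     (\<forall>X\<in>cat_ob C. \<forall>Y\<in>cat_ob C. \<forall>Z\<in>cat_ob C. \<forall>f\<in>cat_hom C X Y. \<forall>g\<in>cat_hom C Y Z.
        Fm X Z (cat_comp C X Y Z g f) = cat_comp D (Fo X) (Fo Y) (Fo Z) (Fm Y Z g) (Fm X Y f))"


section \<open>Finite simple graphs\<close>

record 'a sgraph =
  verts :: "'a set"
  edges :: "'a set set"

definition finite_simple_graph :: "'a sgraph \<Rightarrow> bool" where
  "finite_simple_graph G \<longleftrightarrow> finite (verts G) \<and> (\<forall>e\<in>edges G. e \<subseteq> verts G \<and> card e = 2)"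

text \<open>Morphisms are extensional functions (\<open>undefined\<close> off the vertex set), so that equality of
  morphisms is equality of vertex maps.\<close>

definition graph_hom :: "'a sgraph \<Rightarrow> 'a sgraph \<Rightarrow> ('a \<Rightarrow> 'a) set" where
  "graph_hom F G = {f \<in> verts F \<rightarrow>\<^sub>E verts G. \<forall>e\<in>edges F. f ` e \<in> edges G}"

definition graph_cat :: "('a sgraph, 'a \<Rightarrow> 'a) cat" where
  "graph_cat =
     \<lparr>cat_ob = Collect finite_simple_graph,
      cat_hom = graph_hom,
      cat_id = (\<lambda>G. \<lambda>v\<in>verts G. v),
      cat_comp = (\<lambda>F G K g f. compose (verts F) g f)\<rparr>"


section \<open>Graded rational algebras\<close>

definition rat_ring :: "rat ring" where
  "rat_ring = \<lparr>carrier = UNIV, mult = (*), one = 1, zero = 0, add = (+)\<rparr>"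

record 'h galg = "(rat, 'h) module" +
  grade :: "nat \<Rightarrow> 'h set"

definition hom_decomp :: "'h galg \<Rightarrow> 'h \<Rightarrow> (nat \<Rightarrow> 'h) \<Rightarrow> bool" where
  "hom_decomp A x c \<longleftrightarrow>
     (\<forall>k. c k \<in> grade A k) \<and> finite {k. c k \<noteq> \<zero>\<^bsub>A\<^esub>} \<and>
     x = (\<Oplus>\<^bsub>A\<^esub>k\<in>{k. c k \<noteq> \<zero>\<^bsub>A\<^esub>}. c k)"

text \<open>Not the locale \<open>algebra\<close> of HOL-Algebra, which requires commutativity.\<close>

definition graded_algebra :: "'h galg \<Rightarrow> bool" where
  "graded_algebra A \<longleftrightarrow>
     ring A \<and> module rat_ring A \<and>
     (\<forall>q. \<forall>x\<in>carrier A. \<forall>y\<in>carrier A.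
        (q \<odot>\<^bsub>A\<^esub> x) \<otimes>\<^bsub>A\<^esub> y = q \<odot>\<^bsub>A\<^esub> (x \<otimes>\<^bsub>A\<^esub> y) \<and>
        x \<otimes>\<^bsub>A\<^esub> (q \<odot>\<^bsub>A\<^esub> y) = q \<odot>\<^bsub>A\<^esub> (x \<otimes>\<^bsub>A\<^esub> y)) \<and>
     (\<forall>k. submodule (grade A k) rat_ring A) \<and>
     \<one>\<^bsub>A\<^esub> \<in> grade A 0 \<and>
     (\<forall>i j. \<forall>x\<in>grade A i. \<forall>y\<in>grade A j. x \<otimes>\<^bsub>A\<^esub> y \<in> grade A (i + j)) \<and>
     (\<forall>x\<in>carrier A. \<exists>!c. hom_decomp A x c)"

definition galg_hom :: "'h galg \<Rightarrow> 'h galg \<Rightarrow> ('h \<Rightarrow> 'h) set" where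
  "galg_hom A B =
     {f \<in> ring_hom A B. f \<in> extensional (carrier A) \<and>
        (\<forall>q. \<forall>x\<in>carrier A. f (q \<odot>\<^bsub>A\<^esub> x) = q \<odot>\<^bsub>B\<^esub> f x) \<and>
        (\<forall>k. f ` grade A k \<subseteq> grade B k)}"

definition galg_cat :: "('h galg, 'h \<Rightarrow> 'h) cat" where
  "galg_cat =
     \<lparr>cat_ob = Collect graded_algebra,
      cat_hom = galg_hom,
      cat_id = (\<lambda>A. \<lambda>x\<in>carrier A. x),
      cat_comp = (\<lambda>A B C g f. compose (carrier A) g f)\<rparr>"

definition graded_subalgebra :: "'h set \<Rightarrow> 'h galg \<Rightarrow> bool" where
  "graded_subalgebra S A \<longleftrightarrow>
     subring S A \<and> (\<forall>q. \<forall>x\<in>S. q \<odot>\<^bsub>A\<^esub> x \<in> S) \<and>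
     (\<forall>x\<in>S. \<forall>c. hom_decomp A x c \<longrightarrow> (\<forall>k. c k \<in> S))"

definition generated_galg :: "'h galg \<Rightarrow> 'h set \<Rightarrow> 'h set" where
  "generated_galg A X = \<Inter>{S. graded_subalgebra S A \<and> X \<subseteq> S}"

definition restrict_galg :: "'h galg \<Rightarrow> 'h set \<Rightarrow> 'h galg" where
  "restrict_galg A S = A\<lparr>carrier := S, grade := (\<lambda>k. grade A k \<inter> S)\<rparr>"

definition galg_pair_cat :: "('h galg \<times> 'h set, 'h \<Rightarrow> 'h) cat" where
  "galg_pair_cat =
     \<lparr>cat_ob = {(A, S). graded_algebra A \<and> graded_subalgebra S A},
      cat_hom = (\<lambda>(A, S) (B, T). {f \<in> galg_hom A B. f ` S \<subseteq> T}),
      cat_id = (\<lambda>(A, S). \<lambda>x\<in>carrier A. x),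
      cat_comp = (\<lambda>(A, S) _ _ g f. compose (carrier A) g f)\<rparr>"


section \<open>Rational singular cohomology\<close>

text \<open>A total cochain assigns a number to a degree and a simplex of that degree; it vanishes off the
  singular simplices and in all but finitely many degrees.\<close>

type_synonym 'x cochain = "nat \<Rightarrow> ((nat \<Rightarrow> real) \<Rightarrow> 'x) \<Rightarrow> rat"

definition cochains :: "'x topology \<Rightarrow> 'x cochain set" where
  "cochains X =
     {c. (\<forall>p s. \<not> singular_simplex p X s \<longrightarrow> c p s = 0) \<and> finite {p. \<exists>s. c p s \<noteq> 0}}"

definition coboundary :: "'x topology \<Rightarrow> 'x cochain \<Rightarrow> 'x cochain" where
  "coboundary X c =
     (\<lambda>p s. if singular_simplex p X s \<and> 0 < p
            then (\<Sum>k\<le>p. (-1) ^ k * c (p - 1) (singular_face p k s)) else 0)"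

text \<open>The face of a simplex spanned by its first \<open>i + 1\<close>, respectively its last \<open>q + 1\<close>, vertices,
  the latter being those with index at least \<open>i\<close>.\<close>

definition front_face :: "nat \<Rightarrow> ((nat \<Rightarrow> real) \<Rightarrow> 'x) \<Rightarrow> (nat \<Rightarrow> real) \<Rightarrow> 'x" where
  "front_face i s = restrict s (standard_simplex i)"

definition back_face :: "nat \<Rightarrow> nat \<Rightarrow> ((nat \<Rightarrow> real) \<Rightarrow> 'x) \<Rightarrow> (nat \<Rightarrow> real) \<Rightarrow> 'x" where
  "back_face i q s = (\<lambda>t\<in>standard_simplex q. s (\<lambda>j. if j < i then 0 else t (j - i)))"

definition cup :: "'x topology \<Rightarrow> 'x cochain \<Rightarrow> 'x cochain \<Rightarrow> 'x cochain" where
  "cup X a b =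
     (\<lambda>p s. if singular_simplex p X s
            then (\<Sum>i\<le>p. a i (front_face i s) * b (p - i) (back_face i (p - i) s)) else 0)"

definition cochain_ring :: "'x topology \<Rightarrow> 'x cochain ring" where
  "cochain_ring X =
     \<lparr>carrier = cochains X, mult = cup X,
      one = (\<lambda>p s. if p = 0 \<and> singular_simplex 0 X s then 1 else 0),
      zero = (\<lambda>p s. 0), add = (\<lambda>a b p s. a p s + b p s)\<rparr>"

definition cocycles :: "'x topology \<Rightarrow> 'x cochain set" where
  "cocycles X = {c \<in> cochains X. coboundary X c = (\<lambda>p s. 0)}"

definition coboundaries :: "'x topology \<Rightarrow> 'x cochain set" where
  "coboundaries X = coboundary X ` cochains X"

text \<open>The elements of the total cohomology algebra, the direct sum of all cohomology groups, are cosets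
  of the total coboundaries in the total cocycles.\<close>

definition coh_class :: "'x topology \<Rightarrow> 'x cochain \<Rightarrow> 'x cochain set" where
  "coh_class X c = coboundaries X +>\<^bsub>cochain_ring X\<^esub> c"

definition coh_ring :: "'x topology \<Rightarrow> 'x cochain set ring" where
  "coh_ring X = (cochain_ring X)\<lparr>carrier := cocycles X\<rparr> Quot coboundaries X"

definition coh :: "'x topology \<Rightarrow> 'x cochain set galg" where
  "coh X =
     \<lparr>carrier = carrier (coh_ring X), mult = mult (coh_ring X), one = one (coh_ring X),
      zero = zero (coh_ring X), add = add (coh_ring X),
      smult = (\<lambda>q K. \<Union>c\<in>K. coh_class X (\<lambda>p s. q * c p s)),
      grade = (\<lambda>k. {coh_class X c |c. c \<in> cocycles X \<and> (\<forall>p s. p \<noteq> k \<longrightarrow> c p s = 0)})\<rparr>"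

text \<open>The map on cohomology induced by a continuous map \<open>f\<close> from \<open>X\<close> to \<open>Y\<close>.\<close>

definition cochain_pullback :: "'x topology \<Rightarrow> ('x \<Rightarrow> 'y) \<Rightarrow> 'y cochain \<Rightarrow> 'x cochain" where
  "cochain_pullback X f c =
     (\<lambda>p s. if singular_simplex p X s then c p (simplex_map p f s) else 0)"

definition coh_map ::
  "'x topology \<Rightarrow> 'y topology \<Rightarrow> ('x \<Rightarrow> 'y) \<Rightarrow> 'y cochain set \<Rightarrow> 'x cochain set" where
  "coh_map X Y f = (\<lambda>K\<in>carrier (coh Y). \<Union>c\<in>K. coh_class X (cochain_pullback X f c))"


section \<open>Grassmannians\<close>

definition quotient_topology :: "'x topology \<Rightarrow> ('x \<Rightarrow> 'y) \<Rightarrow> 'y topology" where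
  "quotient_topology X f =
     topology (\<lambda>U. U \<subseteq> f ` topspace X \<and> openin X {x \<in> topspace X. f x \<in> U})"

lemma openin_quotient_topology:
  "openin (quotient_topology X f) U \<longleftrightarrow>
     U \<subseteq> f ` topspace X \<and> openin X {x \<in> topspace X. f x \<in> U}"
proof -
  have "istopology (\<lambda>U. U \<subseteq> f ` topspace X \<and> openin X {x \<in> topspace X. f x \<in> U})"
    unfolding istopology_def
  proof (intro conjI allI impI)
    fix S T
    assume S: "S \<subseteq> f ` topspace X \<and> openin X {x \<in> topspace X. f x \<in> S}"
      and T: "T \<subseteq> f ` topspace X \<and> openin X {x \<in> topspace X. f x \<in> T}"
    show "S \<inter> T \<subseteq> f ` topspace X" using S by blast
    have "{x \<in> topspace X. f x \<in> S \<inter> T} = {x \<in> topspace X. f x \<in> S} \<inter> {x \<in> topspace X. f x \<in> T}"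
      by blast
    then show "openin X {x \<in> topspace X. f x \<in> S \<inter> T}" using S T by auto
  next
    fix \<U>
    assume \<U>: "\<forall>K\<in>\<U>. K \<subseteq> f ` topspace X \<and> openin X {x \<in> topspace X. f x \<in> K}"
    show "\<Union>\<U> \<subseteq> f ` topspace X" using \<U> by blast
    have "{x \<in> topspace X. f x \<in> \<Union>\<U>} = (\<Union>K\<in>\<U>. {x \<in> topspace X. f x \<in> K})"
      by blast
    then show "openin X {x \<in> topspace X. f x \<in> \<Union>\<U>}" using \<U> by auto
  qed
  then show ?thesis
    unfolding quotient_topology_def by (simp add: topology_inverse')
qed

lemma topspace_quotient_topology: "topspace (quotient_topology X f) = f ` topspace X"
proof -
  have "{x \<in> topspace X. f x \<in> f ` topspace X} = topspace X" by blast
  then have "openin (quotient_topology X f) (f ` topspace X)"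
    by (simp add: openin_quotient_topology)
  then show ?thesis
    by (meson openin_quotient_topology openin_subset openin_topspace subset_antisym)
qed

definition cscale :: "complex \<Rightarrow> ('i \<Rightarrow> complex) \<Rightarrow> 'i \<Rightarrow> complex" where
  "cscale a v = (\<lambda>i. a * v i)"

global_interpretation cfun: vector_space cscale
  by unfold_locales (auto simp: cscale_def algebra_simps fun_eq_iff)

text \<open>Complex \<open>n\<close>-space is the space of sequences vanishing from index \<open>n\<close> on.\<close>

definition Cspace :: "nat \<Rightarrow> (nat \<Rightarrow> complex) topology" where
  "Cspace n = subtopology (product_topology (\<lambda>_. euclidean) UNIV) {v. \<forall>i\<ge>n. v i = 0}"

definition frames :: "nat \<Rightarrow> nat \<Rightarrow> (nat \<Rightarrow> nat \<Rightarrow> complex) topology" where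
  "frames k n =
     subtopology (product_topology (\<lambda>_. Cspace n) {..<k})
       {v. inj_on v {..<k} \<and> cfun.independent (v ` {..<k})}"

definition Gr :: "nat \<Rightarrow> nat \<Rightarrow> (nat \<Rightarrow> complex) set topology" where
  "Gr k n = quotient_topology (frames k n) (\<lambda>v. cfun.span (v ` {..<k}))"

definition projective_space :: "nat \<Rightarrow> (nat \<Rightarrow> complex) set topology" where
  "projective_space n = Gr 1 n"


section \<open>Complex vector bundles and Chern classes\<close>

text \<open>The fibres of a bundle are presented as linear subspaces of a space of complex functions, and its
  total space as a topology on the set of pairs \<open>(b, v)\<close> with \<open>v\<close> in the fibre over \<open>b\<close>.\<close>

record ('b, 'i) cbundle =
  base :: "'b topology"
  fib :: "'b \<Rightarrow> ('i \<Rightarrow> complex) set"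
  tot :: "('b \<times> ('i \<Rightarrow> complex)) topology"

definition taut_bundle :: "nat \<Rightarrow> nat \<Rightarrow> ((nat \<Rightarrow> complex) set, nat) cbundle" where
  "taut_bundle k n =
     \<lparr>base = Gr k n, fib = (\<lambda>W. W),
      tot = subtopology (prod_topology (Gr k n) (Cspace n)) {(W, v). v \<in> W}\<rparr>"

text \<open>Linear functionals on a fibre, extended by zero.\<close>

definition dual_fib :: "('i \<Rightarrow> complex) set \<Rightarrow> (('i \<Rightarrow> complex) \<Rightarrow> complex) set" where
  "dual_fib V =
     {\<phi>. (\<forall>v\<in>V. \<forall>w\<in>V. \<phi> (v + w) = \<phi> v + \<phi> w) \<and> (\<forall>a. \<forall>v\<in>V. \<phi> (cscale a v) = a * \<phi> v) \<and>
         (\<forall>v. v \<notin> V \<longrightarrow> \<phi> v = 0)}"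

text \<open>The dual bundle carries the coarsest topology for which the projection is continuous and every
  continuous local section \<open>s\<close> of \<open>E\<close> gives a continuous function \<open>(b, \<phi>) \<mapsto> \<phi> (s b)\<close>.
  A local frame of \<open>E\<close> then yields a local trivialisation of the dual.\<close>

definition dual_bundle :: "('b, 'i) cbundle \<Rightarrow> ('b, 'i \<Rightarrow> complex) cbundle" where
  "dual_bundle E =
     \<lparr>base = base E, fib = (\<lambda>b. dual_fib (fib E b)),
      tot = topology_generated_by
        {{(b, \<phi>). b \<in> U \<and> \<phi> \<in> dual_fib (fib E b) \<and> \<phi> (s b) \<in> Z} |U s Z.
           openin (base E) U \<and> open Z \<and>
           continuous_map (subtopology (base E) U) (tot E) (\<lambda>b. (b, s b))}\<rparr>"

definition proj_bundle :: "('b, 'i) cbundle \<Rightarrow> ('b \<times> ('i \<Rightarrow> complex) set) topology" where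
  "proj_bundle E =
     quotient_topology (subtopology (tot E) {(b, v). v \<noteq> 0}) (\<lambda>(b, v). (b, cfun.span {v}))"

text \<open>The positively oriented fundamental 2-cycle of the line spanned by the first two coordinate vectors
  is \<open>line_simplex - line_const\<close>: the map \<open>line_simplex\<close> collapses the boundary of the 2-simplex to the
  point spanned by the second coordinate vector, and in the affine coordinate \<open>z \<mapsto> [1 : z]\<close> it
  maps the interior onto the plane by an orientation preserving homeomorphism.\<close>

definition line_simplex :: "(nat \<Rightarrow> real) \<Rightarrow> (nat \<Rightarrow> complex) set" where
  "line_simplex = (\<lambda>t\<in>standard_simplex 2. cfun.span {\<lambda>i.
     if i = 0 then complex_of_real (t 0 * t 1 * t 2)
     else if i = 1 then complex_of_real (t 0) + cis (2 * pi / 3) * complex_of_real (t 1)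
                        + cis (4 * pi / 3) * complex_of_real (t 2)
     else 0})"

definition line_const :: "(nat \<Rightarrow> real) \<Rightarrow> (nat \<Rightarrow> complex) set" where
  "line_const = (\<lambda>t\<in>standard_simplex 2. cfun.span {\<lambda>i. if i = 1 then 1 else 0})"

text \<open>For \<open>N \<ge> 2\<close> this is the first Chern class of the dual of the tautological line bundle on the
  projective space of \<open>N\<close>-space: the class with value 1 on a positively oriented line.\<close>

definition hyperplane_class :: "nat \<Rightarrow> (nat \<Rightarrow> complex) set cochain set" where
  "hyperplane_class N =
     (THE K. K \<in> grade (coh (projective_space N)) 2 \<and>
             (\<forall>c\<in>K. c 2 line_simplex - c 2 line_const = 1))"

definition gauss_map ::
  "nat \<Rightarrow> ('b, 'i) cbundle \<Rightarrow> ('b \<times> ('i \<Rightarrow> complex) \<Rightarrow> nat \<Rightarrow> complex) \<Rightarrow> bool" where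
  "gauss_map N E g \<longleftrightarrow>
     continuous_map (tot E) (Cspace N) g \<and>
     (\<forall>b\<in>topspace (base E).
        (\<forall>v\<in>fib E b. \<forall>w\<in>fib E b. g (b, v + w) = g (b, v) + g (b, w)) \<and>
        (\<forall>a. \<forall>v\<in>fib E b. g (b, cscale a v) = cscale a (g (b, v))) \<and>
        inj_on (\<lambda>v. g (b, v)) (fib E b))"

text \<open>The first Chern class of the dual of the tautological line bundle on \<open>proj_bundle E\<close>. A Gauss map
  of \<open>E\<close> identifies this line bundle with a pullback from a projective space.\<close>

definition taut_class ::
  "nat \<Rightarrow> ('b, 'i) cbundle \<Rightarrow> ('b \<times> ('i \<Rightarrow> complex) \<Rightarrow> nat \<Rightarrow> complex)
     \<Rightarrow> ('b \<times> ('i \<Rightarrow> complex) set) cochain set" where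
  "taut_class N E g =
     coh_map (proj_bundle E) (projective_space N) (\<lambda>(b, l). (\<lambda>v. g (b, v)) ` l) (hyperplane_class N)"

text \<open>Grothendieck's definition of the Chern classes of a vector bundle \<open>E\<close> of rank \<open>r\<close> over a compact
  Hausdorff space. For the tautological line bundle \<open>L\<close> on the bundle of lines in \<open>E\<close>, and
  \<open>\<zeta> = c\<^sub>1(L\<^sup>*)\<close>, the relation below says \<open>c\<^sub>r(\<pi>\<^sup>*E \<otimes> L\<^sup>*) = 0\<close>.\<close>

definition is_chern_classes :: "nat \<Rightarrow> ('b, 'i) cbundle \<Rightarrow> (nat \<Rightarrow> 'b cochain set) \<Rightarrow> bool" where
  "is_chern_classes r E c \<longleftrightarrow>
     (\<forall>i. c i \<in> grade (coh (base E)) (2 * i)) \<and>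
     c 0 = \<one>\<^bsub>coh (base E)\<^esub> \<and> (\<forall>i>r. c i = \<zero>\<^bsub>coh (base E)\<^esub>) \<and>
     (\<exists>N\<ge>2. \<exists>g. gauss_map N E g \<and>
        (\<Oplus>\<^bsub>coh (proj_bundle E)\<^esub>i\<in>{..r}.
            coh_map (proj_bundle E) (base E) fst (c i)
              \<otimes>\<^bsub>coh (proj_bundle E)\<^esub> taut_class N E g [^]\<^bsub>coh (proj_bundle E)\<^esub> (r - i))
        = \<zero>\<^bsub>coh (proj_bundle E)\<^esub>)"

text \<open>By the projective bundle theorem the first case applies to every vector bundle of rank \<open>r\<close> over a
  compact Hausdorff space; the value zero is a convention for arguments that are no such bundles.\<close>

definition chern_class :: "nat \<Rightarrow> ('b, 'i) cbundle \<Rightarrow> nat \<Rightarrow> 'b cochain set" where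
  "chern_class r E i =
     (if \<exists>!c. is_chern_classes r E c then (THE c. is_chern_classes r E c) i else \<zero>\<^bsub>coh (base E)\<^esub>)"


section \<open>Graph configuration spaces and edge-span algebras\<close>

definition graph_conf :: "'a sgraph \<Rightarrow> 'x topology \<Rightarrow> ('a \<Rightarrow> 'x) topology" where
  "graph_conf G X =
     subtopology (product_topology (\<lambda>_. X) (verts G)) {x. \<forall>u v. {u, v} \<in> edges G \<longrightarrow> x u \<noteq> x v}"

definition conf_map :: "'a sgraph \<Rightarrow> ('a \<Rightarrow> 'b) \<Rightarrow> ('b \<Rightarrow> 'x) \<Rightarrow> 'a \<Rightarrow> 'x" where
  "conf_map F f x = (\<lambda>v\<in>verts F. x (f v))"

abbreviation proj_conf :: "nat \<Rightarrow> 'a sgraph \<Rightarrow> ('a \<Rightarrow> (nat \<Rightarrow> complex) set) topology" where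
  "proj_conf n G \<equiv> graph_conf G (projective_space n)"

definition edge_plane :: "'a set \<Rightarrow> ('a \<Rightarrow> (nat \<Rightarrow> complex) set) \<Rightarrow> (nat \<Rightarrow> complex) set" where
  "edge_plane e x = cfun.span (\<Union>w\<in>e. x w)"

definition edge_class ::
  "nat \<Rightarrow> nat \<Rightarrow> 'a sgraph \<Rightarrow> 'a set \<Rightarrow> ('a \<Rightarrow> (nat \<Rightarrow> complex) set) cochain set" where
  "edge_class i n G e =
     coh_map (proj_conf n G) (Gr 2 n) (edge_plane e)
       (chern_class 2 (dual_bundle (taut_bundle 2 n)) i)"

definition conf_coh :: "nat \<Rightarrow> 'a sgraph \<Rightarrow> ('a \<Rightarrow> (nat \<Rightarrow> complex) set) cochain set galg" where
  "conf_coh n G = coh (proj_conf n G)"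

definition conf_coh_map ::
  "nat \<Rightarrow> 'a sgraph \<Rightarrow> 'a sgraph \<Rightarrow> ('a \<Rightarrow> 'a) \<Rightarrow>
     ('a \<Rightarrow> (nat \<Rightarrow> complex) set) cochain set \<Rightarrow> ('a \<Rightarrow> (nat \<Rightarrow> complex) set) cochain set" where
  "conf_coh_map n F G f = coh_map (proj_conf n G) (proj_conf n F) (conf_map F f)"

definition edge_span :: "nat \<Rightarrow> 'a sgraph \<Rightarrow> ('a \<Rightarrow> (nat \<Rightarrow> complex) set) cochain set set" where
  "edge_span n G =
     generated_galg (conf_coh n G) (\<Union>e\<in>edges G. {edge_class 1 n G e, edge_class 2 n G e})"

end

theory Submission
  imports Defs
begin

text \<open>
  A continuous map pulls singular cochains back compatibly with coboundaries and cup products, so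
  rational cohomology is a contravariant functor to graded algebras, and a graph homomorphism
  \<open>f : F \<rightarrow> G\<close> induces a continuous map \<open>f\<^sub>X : Conf\<^sub>G(X) \<rightarrow> Conf\<^sub>F(X)\<close> contravariantly in \<open>f\<close>. The span of the
  two lines at the ends of an edge \<open>e\<close> of \<open>F\<close>, taken after \<open>f\<^sub>X\<close>, is the span at the edge \<open>f(e)\<close> of
  \<open>G\<close>. Hence \<open>f\<^sub>X\<^sup>*\<close> sends the generators at \<open>e\<close> to those at \<open>f(e)\<close>, and so it maps the edge-span
  algebra of \<open>F\<close> into that of \<open>G\<close>. Of the Chern classes only membership in the cohomology of the
  Grassmannian is used; the geometric input is the continuity of the edge planes, which holds since
  lines have continuous spanning vectors locally.
\<close>

section \<open>Faces of simplices\<close>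

text \<open>Cohomology is total here: a cochain may mix degrees, and a class is a coset of all
  coboundaries in all cocycles. Every statement about the grading therefore goes through the
  projections \<open>cochain_part k\<close>. It works because the coboundary raises degrees by
  exactly one and cup products add them. On cochains the cup product is already associative and
  unital, so all laws are checked there before passing to the quotient.

  Pullback respects cocycles and coboundaries only along a continuous map, so even the membership of
  the generators in the cohomology of the configuration space rests on continuity of the edge
  planes. \<open>Gr\<close> carries a quotient topology: a map into it is continuous if it lifts
  locally to frames. Such lifts are built in affine charts, since projective space has no global
  continuous choice of spanning vectors.

  An edge-span algebra is an intersection of graded subalgebras, not a set of expressions in the
  generators. That a map respects these algebras is therefore proved with preimages of subalgebras,
  without induction over generated elements.\<close>

definition shift_point :: "nat \<Rightarrow> (nat \<Rightarrow> real) \<Rightarrow> nat \<Rightarrow> real" where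
  "shift_point i t = (\<lambda>j. if j < i then 0 else t (j - i))"

text \<open>\<open>shift_point i\<close> is the affine inclusion of the \<open>q\<close>-simplex
  onto the last \<open>q + 1\<close> vertices of the \<open>(i + q)\<close>-simplex. With back faces
  written through it, identities between them reduce to identities between points.\<close>

lemma back_face_eq: "back_face i q s = restrict (s \<circ> shift_point i) (standard_simplex q)"
  by (simp add: back_face_def shift_point_def comp_def)

lemma shift_point_in_standard_simplex:
  assumes "t \<in> standard_simplex q"
  shows "shift_point i t \<in> standard_simplex (i + q)"
proof -
  have "(\<Sum>j\<le>i + q. shift_point i t j) = (\<Sum>j\<in>(\<lambda>k. k + i) ` {..q}. shift_point i t j)"
  proof (rule sum.mono_neutral_right)
    show "\<forall>j\<in>{..i + q} - (\<lambda>k. k + i) ` {..q}. shift_point i t j = 0"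
    proof
      fix j assume j: "j \<in> {..i + q} - (\<lambda>k. k + i) ` {..q}"
      have "j < i"
      proof (rule ccontr)
        assume "\<not> j < i"
        then have "j = (j - i) + i" "j - i \<in> {..q}" using j by auto
        then show False using j by blast
      qed
      then show "shift_point i t j = 0" by (simp add: shift_point_def)
    qed
  qed auto
  also have "\<dots> = (\<Sum>k\<le>q. t k)"
    by (simp add: sum.reindex shift_point_def)
  finally show ?thesis
    using assms by (auto simp: standard_simplex_def shift_point_def)
qed

lemma shift_point_shift_point: "shift_point i (shift_point j t) = shift_point (i + j) t"
  by (auto simp: shift_point_def fun_eq_iff)

text \<open>\<open>simplical_face k\<close> inserts a zero at position \<open>k\<close>. For
  \<open>k \<le> i\<close> this only lengthens the initial block of zeros; in the next lemma the
  zero falls into the copy of \<open>t\<close>, at position \<open>k - i\<close>.\<close>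

lemma simplical_face_shift_point_le:
  "k \<le> i \<Longrightarrow> simplical_face k (shift_point i t) = shift_point (Suc i) t"
  by (auto simp: shift_point_def simplical_face_def fun_eq_iff intro!: arg_cong[where f = t])

lemma simplical_face_shift_point_gt:
  "i < k \<Longrightarrow> simplical_face k (shift_point i t) = shift_point i (simplical_face (k - i) t)"
  by (auto simp: shift_point_def simplical_face_def fun_eq_iff intro!: arg_cong[where f = t])

text \<open>The coordinates of a point of the \<open>i\<close>-simplex are zero beyond
  \<open>i\<close>, so one more zero inserted there changes nothing.\<close>

lemma simplical_face_vanishing:
  "t \<in> standard_simplex i \<Longrightarrow> i < k \<Longrightarrow> simplical_face k t = t"
  by (auto simp: standard_simplex_def simplical_face_def fun_eq_iff)

lemma front_face_front_face: "j \<le> i \<Longrightarrow> front_face j (front_face i s) = front_face j s"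
  using standard_simplex_mono[of j i]
  by (auto simp: front_face_def restrict_def intro!: ext arg_cong[where f = s])

lemma back_face_back_face:
  "back_face l q (back_face j (l + q) s) = back_face (j + l) q s"
  using shift_point_in_standard_simplex[of _ q l]
  by (auto simp: back_face_eq restrict_def shift_point_shift_point intro!: ext arg_cong[where f = s])

text \<open>Both sides are the face on the vertices \<open>j\<close> to \<open>j + l\<close>, the
  middle one of the three consecutive faces in a triple cup product.\<close>

lemma back_face_front_face:
  "back_face j l (front_face (j + l) s) = front_face l (back_face j (l + q) s)"
  using shift_point_in_standard_simplex[of _ l j] standard_simplex_mono[of l "l + q"]
  by (auto simp: back_face_eq front_face_def restrict_def intro!: ext arg_cong[where f = s])

text \<open>The four rules up to \<open>back_face_singular_face_gt\<close> compare deleting vertex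
  \<open>k\<close> with cutting at vertex \<open>i\<close>. The exceptional cases,
  \<open>k = Suc i\<close> here and \<open>k = 0\<close> in the last rule, delete the vertex where
  the front and the back face meet; they produce the two boundary terms of the Leibniz rule.\<close>

lemma front_face_singular_face_le:
  assumes "k \<le> Suc i" "i \<le> p"
  shows "singular_face (Suc i) k (front_face (Suc i) s) =
    (if k \<le> i then front_face i (singular_face (Suc p) k s) else front_face i s)"
proof -
  have "simplical_face k t \<in> standard_simplex (Suc i)" if "t \<in> standard_simplex i" for t
    using simplical_face_in_standard_simplex[of "Suc i" k t] that assms by simp
  then show ?thesis
    using assms standard_simplex_mono[of i p] simplical_face_vanishing[of _ i k]
    by (auto simp: front_face_def singular_face_def restrict_def intro!: ext arg_cong[where f = s])
qed

lemma front_face_singular_face_gt: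
  assumes "i < k" "i \<le> p"
  shows "front_face i (singular_face (Suc p) k s) = front_face i s"
  using assms standard_simplex_mono[of i p] simplical_face_vanishing[of _ i k]
  by (auto simp: front_face_def singular_face_def restrict_def intro!: ext arg_cong[where f = s])

lemma back_face_singular_face_le:
  assumes "k \<le> i"
  shows "back_face i q (singular_face (Suc (i + q)) k s) = back_face (Suc i) q s"
  using assms shift_point_in_standard_simplex[of _ q i]
  by (auto simp: back_face_eq singular_face_def restrict_def simplical_face_shift_point_le
      intro!: ext arg_cong[where f = s])

lemma back_face_singular_face_gt:
  assumes "k \<le> Suc q"
  shows "singular_face (Suc q) k (back_face i (Suc q) s) =
    (if k = 0 then back_face (Suc i) q s else back_face i q (singular_face (Suc (i + q)) (k + i) s))"
proof -
  have "simplical_face k t \<in> standard_simplex (Suc q)" if "t \<in> standard_simplex q" for t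
    using simplical_face_in_standard_simplex[of "Suc q" k t] that assms by simp
  moreover have "shift_point i (simplical_face 0 t) = shift_point (Suc i) t" for t
    by (auto simp: shift_point_def simplical_face_def restrict_def intro!: ext arg_cong[where f = s])
  ultimately show ?thesis
    using assms shift_point_in_standard_simplex[of _ q i]
    by (auto simp: back_face_eq singular_face_def restrict_def simplical_face_shift_point_gt
        intro!: ext arg_cong[where f = s])
qed

lemma singular_simplex_front_face:
  assumes "singular_simplex p X s" "i \<le> p"
  shows "singular_simplex i X (front_face i s)"
proof -
  have "continuous_map (subtopology (powertop_real UNIV) (standard_simplex i)) X s"
    using assms continuous_map_from_subtopology_mono standard_simplex_mono
    unfolding singular_simplex_def by blast
  then show ?thesis
    by (auto simp: singular_simplex_def front_face_def elim: continuous_map_eq)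
qed

lemma continuous_map_shift_point:
  "continuous_map (subtopology (powertop_real UNIV) (standard_simplex q))
     (subtopology (powertop_real UNIV) (standard_simplex (i + q))) (shift_point i)"
proof -
  have "continuous_map (powertop_real UNIV) euclideanreal (\<lambda>t. shift_point i t j)" for j
    by (cases "j < i") (auto simp: shift_point_def intro: continuous_map_product_projection)
  then have "continuous_map (powertop_real UNIV) (powertop_real UNIV) (shift_point i)"
    by (simp add: continuous_map_componentwise)
  then show ?thesis
    by (auto simp: continuous_map_in_subtopology continuous_map_from_subtopology
        shift_point_in_standard_simplex)
qed

lemma singular_simplex_back_face:
  assumes "singular_simplex (i + q) X s"
  shows "singular_simplex q X (back_face i q s)"
proof -
  have "continuous_map (subtopology (powertop_real UNIV) (standard_simplex q)) X (s \<circ> shift_point i)"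
    using assms continuous_map_compose[OF continuous_map_shift_point]
    unfolding singular_simplex_def by blast
  then show ?thesis
    by (auto simp: singular_simplex_def back_face_eq elim: continuous_map_eq)
qed

lemma singular_face_singular_face:
  assumes "i \<le> j" "j \<le> p"
  shows "singular_face p i (singular_face (Suc p) (Suc j) s) =
         singular_face p j (singular_face (Suc p) i s)"
proof (cases "p = 0")
  \<comment> \<open>Here \<open>i = j = 0\<close>, and the faces are degenerate:
    \<open>p - 1\<close> truncates to 0, the face map moves the point of the 0-simplex out of the
    domain, and both sides are \<open>undefined\<close> there.\<close>
  case True
  then show ?thesis using assms
    by (auto simp: singular_face_def restrict_def standard_simplex_0 simplical_face_def
        intro!: ext arg_cong[where f = s])
next
  case False
  have "simplical_face (Suc j) (simplical_face i t) = simplical_face i (simplical_face j t)"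
    for t :: "nat \<Rightarrow> real"
    using assms by (force simp: simplical_face_def restrict_def)
  moreover have "simplical_face k t \<in> standard_simplex p"
    if "t \<in> standard_simplex (p - Suc 0)" "k \<le> p" for t k
    using that False simplical_face_in_standard_simplex by force
  ultimately show ?thesis
    using assms by (auto simp: singular_face_def restrict_def intro!: ext arg_cong[where f = s])
qed

section \<open>The ring of cochains\<close>

definition scale_cochain :: "rat \<Rightarrow> 'x cochain \<Rightarrow> 'x cochain" where
  "scale_cochain q c = (\<lambda>p s. q * c p s)"

text \<open>Twisting by the sign of the degree states the Leibniz rule for cochains that need not be
  homogeneous.\<close>

definition sign_cochain :: "'x cochain \<Rightarrow> 'x cochain" where
  "sign_cochain c = (\<lambda>p s. (-1) ^ p * c p s)"

definition cochain_part :: "nat \<Rightarrow> 'x cochain \<Rightarrow> 'x cochain" where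
  "cochain_part k c = (\<lambda>p s. if p = k then c p s else 0)"

text \<open>The record operations become the pointwise ones of function types, so that additive
  identities between cochains are type class arithmetic.\<close>

lemma cochain_ring_simps [simp]:
  "carrier (cochain_ring X) = cochains X" "mult (cochain_ring X) = cup X"
  "add (cochain_ring X) = (+)" "zero (cochain_ring X) = 0"
  by (auto simp: cochain_ring_def fun_eq_iff)

lemma one_cochain_apply:
  "\<one>\<^bsub>cochain_ring X\<^esub> p s = (if p = 0 \<and> singular_simplex 0 X s then 1 else 0)"
  by (simp add: cochain_ring_def)

lemma sum_cochain_apply: "sum f A p s = (\<Sum>k\<in>A. f k p s)" for f :: "'i \<Rightarrow> 'x cochain"
  by (induction A rule: infinite_finite_induct) auto

text \<open>Any finite set of degrees may serve as a bound, not only the exact support. Sums, cup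
  products and coboundaries then get their bounds as unions, sumsets and shifts of given
  ones.\<close>

lemma mem_cochainsI:
  assumes "\<And>p s. \<not> singular_simplex p X s \<Longrightarrow> c p s = 0"
    and "finite A" "\<And>p s. p \<notin> A \<Longrightarrow> c p s = 0"
  shows "c \<in> cochains X"
proof -
  have "{p. \<exists>s. c p s \<noteq> 0} \<subseteq> A"
    using assms(3) by blast
  then show ?thesis
    using assms(1) finite_subset[OF _ assms(2)] by (auto simp: cochains_def)
qed

lemma cochains_zero: "c \<in> cochains X \<Longrightarrow> \<not> singular_simplex p X s \<Longrightarrow> c p s = 0"
  by (simp add: cochains_def)

lemma cochains_degrees:
  "c \<in> cochains X \<Longrightarrow> \<exists>A. finite A \<and> (\<forall>p s. p \<notin> A \<longrightarrow> c p s = 0)"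
  by (intro exI[of _ "{p. \<exists>s. c p s \<noteq> 0}"]) (simp add: cochains_def)

lemma mem_cochains_mono:
  assumes "a \<in> cochains X" "\<And>p s. a p s = 0 \<Longrightarrow> b p s = 0"
  shows "b \<in> cochains X"
proof -
  obtain A where A: "finite A" "\<And>p s. p \<notin> A \<Longrightarrow> a p s = 0"
    using cochains_degrees[OF assms(1)] by blast
  show ?thesis
    by (rule mem_cochainsI[OF _ A(1)]) (simp_all add: assms A cochains_zero[OF assms(1)])
qed

lemma zero_in_cochains [simp, intro]: "0 \<in> cochains X"
  by (rule mem_cochainsI[of _ _ "{}"]) auto

lemma add_in_cochains [simp, intro]:
  assumes "a \<in> cochains X" "b \<in> cochains X"
  shows "a + b \<in> cochains X"
proof -
  obtain A where "finite A" "\<And>p s. p \<notin> A \<Longrightarrow> a p s = 0"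
    using cochains_degrees[OF assms(1)] by blast
  moreover obtain B where "finite B" "\<And>p s. p \<notin> B \<Longrightarrow> b p s = 0"
    using cochains_degrees[OF assms(2)] by blast
  ultimately show ?thesis
    using assms by (intro mem_cochainsI[of _ _ "A \<union> B"]) (auto simp: cochains_zero)
qed

lemma uminus_in_cochains [simp, intro]: "a \<in> cochains X \<Longrightarrow> - a \<in> cochains X"
  by (simp add: cochains_def)

lemma scale_in_cochains [simp, intro]: "a \<in> cochains X \<Longrightarrow> scale_cochain q a \<in> cochains X"
  by (erule mem_cochains_mono) (simp add: scale_cochain_def)

lemma sign_in_cochains [simp, intro]: "a \<in> cochains X \<Longrightarrow> sign_cochain a \<in> cochains X"
  by (erule mem_cochains_mono) (simp add: sign_cochain_def)

lemma part_in_cochains [simp, intro]: "a \<in> cochains X \<Longrightarrow> cochain_part k a \<in> cochains X"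
  by (erule mem_cochains_mono) (auto simp: cochain_part_def)

lemma one_in_cochains [simp, intro]: "\<one>\<^bsub>cochain_ring X\<^esub> \<in> cochains X"
  by (rule mem_cochainsI[of _ _ "{0}"]) (auto simp: one_cochain_apply)

lemma cup_in_cochains [simp, intro]:
  assumes "a \<in> cochains X" "b \<in> cochains X"
  shows "cup X a b \<in> cochains X"
proof -
  obtain A where A: "finite A" "\<And>p s. p \<notin> A \<Longrightarrow> a p s = 0"
    using cochains_degrees[OF assms(1)] by blast
  obtain B where B: "finite B" "\<And>p s. p \<notin> B \<Longrightarrow> b p s = 0"
    using cochains_degrees[OF assms(2)] by blast
  have "cup X a b p s = 0" if "p \<notin> (\<lambda>(i, j). i + j) ` (A \<times> B)" for p s
  proof -
    have "i \<notin> A \<or> p - i \<notin> B" if "i \<le> p" for i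
      using \<open>p \<notin> _\<close> that by force
    then have "a i t * b (p - i) u = 0" if "i \<le> p" for i t u
      using that A(2) B(2) by (metis mult_zero_left mult_zero_right)
    then show ?thesis
      unfolding cup_def by (auto intro!: sum.neutral simp del: mult_eq_0_iff)
  qed
  then show ?thesis
    using A B by (intro mem_cochainsI[of _ _ "(\<lambda>(i, j). i + j) ` (A \<times> B)"]) (auto simp: cup_def)
qed

lemma coboundary_in_cochains [simp, intro]:
  assumes "a \<in> cochains X"
  shows "coboundary X a \<in> cochains X"
proof -
  obtain A where A: "finite A" "\<And>p s. p \<notin> A \<Longrightarrow> a p s = 0"
    using cochains_degrees[OF assms] by blast
  have "a (p - 1) t = 0" if "p \<notin> Suc ` A" "0 < p" for p t
    using that A(2)[of "p - 1" t] by (metis Suc_pred' image_eqI)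
  then show ?thesis
    using A by (intro mem_cochainsI[of _ _ "Suc ` A"]) (auto simp: coboundary_def intro!: sum.neutral)
qed

section \<open>Algebraic laws of the cup product\<close>

lemma cup_add_left: "cup X (a + b) c = cup X a c + cup X b c"
  by (auto simp: cup_def fun_eq_iff algebra_simps sum.distrib)

lemma cup_add_right: "cup X a (b + c) = cup X a b + cup X a c"
  by (auto simp: cup_def fun_eq_iff algebra_simps sum.distrib)

lemma cup_scale_left: "cup X (scale_cochain q a) b = scale_cochain q (cup X a b)"
  by (auto simp: cup_def scale_cochain_def fun_eq_iff sum_distrib_left mult_ac)

lemma cup_scale_right: "cup X a (scale_cochain q b) = scale_cochain q (cup X a b)"
  by (auto simp: cup_def scale_cochain_def fun_eq_iff sum_distrib_left mult_ac)

lemma cup_zero_left [simp]: "cup X 0 b = 0"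
  by (auto simp: cup_def fun_eq_iff)

lemma cup_zero_right [simp]: "cup X a 0 = 0"
  by (auto simp: cup_def fun_eq_iff)

lemma front_face_full: "singular_simplex p X s \<Longrightarrow> front_face p s = s"
  by (auto simp: front_face_def singular_simplex_def extensional_restrict)

lemma back_face_full: "singular_simplex p X s \<Longrightarrow> back_face 0 p s = s"
  by (auto simp: back_face_def singular_simplex_def extensional_restrict)

lemma cup_one_left:
  assumes "a \<in> cochains X" shows "cup X \<one>\<^bsub>cochain_ring X\<^esub> a = a"
proof (intro ext)
  fix p s
  show "cup X \<one>\<^bsub>cochain_ring X\<^esub> a p s = a p s"
  proof (cases "singular_simplex p X s")
    case True
    \<comment> \<open>Only the cut at vertex 0 survives because the unit lives in degree 0; the
      complementary back face is all of \<open>s\<close>.\<close>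
    then have "cup X \<one>\<^bsub>cochain_ring X\<^esub> a p s = (\<Sum>i\<le>p. if i = 0 then a p s else 0)"
      using singular_simplex_front_face[OF True, of 0]
      unfolding cup_def if_P[OF True]
      by (intro sum.cong refl) (auto simp: one_cochain_apply back_face_full)
    then show ?thesis by simp
  qed (simp add: cup_def cochains_zero[OF assms])
qed

lemma cup_one_right:
  assumes "a \<in> cochains X" shows "cup X a \<one>\<^bsub>cochain_ring X\<^esub> = a"
proof (intro ext)
  fix p s
  show "cup X a \<one>\<^bsub>cochain_ring X\<^esub> p s = a p s"
  proof (cases "singular_simplex p X s")
    case True
    then have "cup X a \<one>\<^bsub>cochain_ring X\<^esub> p s = (\<Sum>i\<le>p. if i = p then a p s else 0)"
      using singular_simplex_back_face[of p 0 X s]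
      unfolding cup_def if_P[OF True]
      by (intro sum.cong refl) (auto simp: one_cochain_apply front_face_full)
    then show ?thesis by simp
  qed (simp add: cup_def cochains_zero[OF assms])
qed

text \<open>Both sides run over the pairs \<open>(j, l)\<close> with \<open>j + l \<le> p\<close>,
  where \<open>i = j + l\<close> on the left. In a cup product these are the ways to cut a
  \<open>p\<close>-simplex twice.\<close>

lemma sum_triangle_swap:
  fixes f :: "nat \<Rightarrow> nat \<Rightarrow> 'b::comm_monoid_add"
  shows "(\<Sum>i\<le>p. \<Sum>j\<le>i. f j (i - j)) = (\<Sum>j\<le>p. \<Sum>l\<le>p - j. f j l)"
proof -
  have "(\<Sum>i\<le>p. \<Sum>j\<le>i. f j (i - j)) = (\<Sum>(i, j)\<in>Sigma {..p} (\<lambda>i. {..i}). f j (i - j))"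
    by (simp add: sum.Sigma)
  also have "\<dots> = (\<Sum>(j, l)\<in>Sigma {..p} (\<lambda>j. {..p - j}). f j l)"
    by (rule sum.reindex_bij_witness[of _ "\<lambda>(j, l). (j + l, j)" "\<lambda>(i, j). (j, i - j)"]) auto
  finally show ?thesis by (simp add: sum.Sigma)
qed

lemma cup_assoc: "cup X (cup X a b) c = cup X a (cup X b c)"
proof (intro ext)
  fix p s
  show "cup X (cup X a b) c p s = cup X a (cup X b c) p s"
  proof (cases "singular_simplex p X s")
    case True
    \<comment> \<open>The contribution of the cut of \<open>s\<close> into consecutive faces of
      dimensions \<open>j\<close>, \<open>l\<close> and \<open>p - j - l\<close>; either bracketing
      sums it over all such cuts.\<close>
    define f where "f j l = a j (front_face j s) * b l (front_face l (back_face j (p - j) s)) *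
        c (p - j - l) (back_face (j + l) (p - j - l) s)" for j l
    have "cup X (cup X a b) c p s = (\<Sum>i\<le>p. \<Sum>j\<le>i. f j (i - j))"
      unfolding cup_def if_P[OF True]
    proof (rule sum.cong[OF refl])
      fix i assume "i \<in> {..p}"
      then have i: "i \<le> p" by simp
      have "back_face j (i - j) (front_face i s) = front_face (i - j) (back_face j (p - j) s)"
        if "j \<le> i" for j
        using back_face_front_face[of j "i - j" s "p - i"] that i by simp
      then show "(if singular_simplex i X (front_face i s)
          then \<Sum>j\<le>i. a j (front_face j (front_face i s)) * b (i - j) (back_face j (i - j) (front_face i s))
          else 0) * c (p - i) (back_face i (p - i) s) = (\<Sum>j\<le>i. f j (i - j))"
        using singular_simplex_front_face[OF True i] i
        by (auto simp: f_def sum_distrib_right front_face_front_face intro!: sum.cong)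
    qed
    also have "\<dots> = (\<Sum>j\<le>p. \<Sum>l\<le>p - j. f j l)"
      by (rule sum_triangle_swap)
    also have "\<dots> = cup X a (cup X b c) p s"
      unfolding cup_def if_P[OF True]
    proof (rule sum.cong[OF refl])
      fix j assume "j \<in> {..p}"
      then have j: "j \<le> p" by simp
      have "back_face l (p - j - l) (back_face j (p - j) s) = back_face (j + l) (p - j - l) s"
        if "l \<le> p - j" for l
        using back_face_back_face[of l "p - j - l" j s] le_add_diff_inverse[OF that] by (simp only:)
      then show "(\<Sum>l\<le>p - j. f j l) = a j (front_face j s) *
          (if singular_simplex (p - j) X (back_face j (p - j) s)
           then \<Sum>l\<le>p - j. b l (front_face l (back_face j (p - j) s)) *
               c (p - j - l) (back_face l (p - j - l) (back_face j (p - j) s)) else 0)"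
        using singular_simplex_back_face[of j "p - j" X s] True j
        by (auto simp: f_def sum_distrib_left mult.assoc intro!: sum.cong)
    qed
    finally show ?thesis .
  qed (simp add: cup_def)
qed

lemma ring_cochain_ring: "ring (cochain_ring X)"
proof (rule ringI)
  show "abelian_group (cochain_ring X)"
    by (rule abelian_groupI) (auto simp: add_ac intro!: bexI[of _ "- _"])
  show "Group.monoid (cochain_ring X)"
    by (rule monoidI) (auto simp: cup_assoc cup_one_left cup_one_right)
qed (auto simp: cup_add_left cup_add_right)

section \<open>The coboundary\<close>

lemma coboundary_add: "coboundary X (a + b) = coboundary X a + coboundary X b"
  by (auto simp: coboundary_def fun_eq_iff algebra_simps sum.distrib)

lemma coboundary_uminus: "coboundary X (- a) = - coboundary X a"
  by (auto simp: coboundary_def fun_eq_iff sum_negf)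

lemma coboundary_zero [simp]: "coboundary X 0 = 0"
  by (auto simp: coboundary_def fun_eq_iff)

lemma coboundary_scale: "coboundary X (scale_cochain q a) = scale_cochain q (coboundary X a)"
  by (auto simp: coboundary_def scale_cochain_def fun_eq_iff sum_distrib_left mult_ac)

text \<open>The coboundary raises degrees by one, so the twists before and after it differ by one
  factor -1.\<close>

lemma coboundary_sign: "coboundary X (sign_cochain a) = - sign_cochain (coboundary X a)"
proof (intro ext)
  fix p s
  show "coboundary X (sign_cochain a) p s = (- sign_cochain (coboundary X a)) p s"
    by (cases p) (auto simp: coboundary_def sign_cochain_def sum_distrib_left mult_ac
        simp del: sum.atMost_Suc simp flip: sum_negf)
qed

text \<open>Homogeneity of the coboundary: the reason why cocycles and coboundaries split into their
  degree components.\<close>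

lemma coboundary_part: "coboundary X (cochain_part k a) = cochain_part (Suc k) (coboundary X a)"
proof (intro ext)
  fix p s
  show "coboundary X (cochain_part k a) p s = cochain_part (Suc k) (coboundary X a) p s"
    by (cases p) (auto simp: coboundary_def cochain_part_def)
qed

lemma part_zero_coboundary: "cochain_part 0 (coboundary X a) = 0"
  by (auto simp: coboundary_def cochain_part_def fun_eq_iff)

text \<open>The two end points of a 1-simplex contribute 1 each, with opposite signs; in other
  degrees no value of the unit is involved.\<close>

lemma coboundary_one: "coboundary X \<one>\<^bsub>cochain_ring X\<^esub> = 0"
proof (intro ext)
  fix p s
  show "coboundary X \<one>\<^bsub>cochain_ring X\<^esub> p s = 0 p s"
  proof (cases "singular_simplex 1 X s \<and> p = 1")
    case True
    then have "singular_simplex 0 X (singular_face 1 k s)" if "k \<le> 1" for k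
      using singular_simplex_singular_face[of 1 X s k] that by simp
    from this[of 0] this[of 1] show ?thesis using True
      by (auto simp: coboundary_def one_cochain_apply)
  next
    case False
    then show ?thesis
      by (cases "p = 1") (auto simp: coboundary_def one_cochain_apply)
  qed
qed

lemma coboundary_coboundary: "coboundary X (coboundary X c) = 0"
proof (intro ext)
  fix p s
  show "coboundary X (coboundary X c) p s = 0 p s"
  proof (cases "\<exists>m. p = Suc (Suc m) \<and> singular_simplex p X s")
    case False
    have "coboundary X c (p - 1) t = 0" if "p = 1" for t
      using that by (simp add: coboundary_def)
    then show ?thesis using False
      by (cases p; cases "p - 1") (auto simp: coboundary_def)
  next
    case True
    then obtain m where p: "p = Suc (Suc m)" and s: "singular_simplex (Suc (Suc m)) X s" by blast
    define f where "f k j = (-1) ^ (k + j) * c m (singular_face (Suc m) j (singular_face (Suc (Suc m)) k s))" for k j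
    let ?S = "{..Suc (Suc m)} \<times> {..Suc m}"
    have "coboundary X (coboundary X c) p s = (\<Sum>k\<le>Suc (Suc m). \<Sum>j\<le>Suc m. f k j)"
      using s p singular_simplex_singular_face[OF s]
      by (auto simp: coboundary_def f_def sum_distrib_left power_add mult_ac
          simp del: sum.atMost_Suc intro!: sum.cong)
    also have "\<dots> = (\<Sum>(k, j)\<in>?S. f k j)"
      by (simp add: sum.cartesian_product del: sum.atMost_Suc)
    also have "\<dots> = (\<Sum>(k, j)\<in>{(k, j) \<in> ?S. j < k}. f k j) + (\<Sum>(k, j)\<in>{(k, j) \<in> ?S. k \<le> j}. f k j)"
      (is "_ = sum _ ?L + sum _ ?R")
    proof -
      have "finite ?L" "finite ?R" by (rule finite_subset[of _ ?S]; auto)+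
      moreover have "?S = ?L \<union> ?R" "?L \<inter> ?R = {}" by auto
      ultimately show ?thesis by (metis (no_types, lifting) sum.union_disjoint)
    qed
    \<comment> \<open>The simplicial identity pairs the term at \<open>(k, i)\<close> with
      \<open>i < k\<close> with the one at \<open>(i, k - 1)\<close>: both delete the same two
      vertices, in opposite orders, and the exponents \<open>k + i\<close> and
      \<open>i + k - 1\<close> have opposite parity.\<close>
    also have "(\<Sum>(k, j)\<in>{(k, j) \<in> ?S. j < k}. f k j) = (\<Sum>(k, j)\<in>{(k, j) \<in> ?S. k \<le> j}. - f k j)"
    proof (rule sum.reindex_bij_witness[of _ "\<lambda>(i, j). (Suc j, i)" "\<lambda>(k, i). (i, k - 1)"], goal_cases)
      case (5 a)
      obtain k i where a: "a = (k, i)" by (cases a)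
      have ki: "i < k" "k \<le> Suc (Suc m)" using 5 a by auto
      have "f i (k - 1) = - f k i"
        using singular_face_singular_face[of i "k - 1" "Suc m" s] ki
        by (cases k) (auto simp: f_def add_ac)
      then show ?case by (simp add: a)
    qed auto
    also have "\<dots> + (\<Sum>(k, j)\<in>{(k, j) \<in> ?S. k \<le> j}. f k j) = 0"
      by (simp add: case_prod_unfold sum_negf)
    finally show ?thesis by simp
  qed
qed

text \<open>Each face of a simplex loses a vertex either from the front or from the back part of a
  cut, which gives the two terms. Twisting \<open>a\<close> as a whole stands for the usual sign in
  its degree.\<close>

lemma coboundary_cup:
  "coboundary X (cup X a b) = cup X (coboundary X a) b + cup X (sign_cochain a) (coboundary X b)"
proof (intro ext)
  fix p s
  show "coboundary X (cup X a b) p s =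
    (cup X (coboundary X a) b + cup X (sign_cochain a) (coboundary X b)) p s"
  proof (cases "\<exists>m. p = Suc m \<and> singular_simplex p X s")
    case False
    then show ?thesis
      by (cases p) (auto simp: coboundary_def cup_def)
  next
    case True
    then obtain m where p: "p = Suc m" and s: "singular_simplex (Suc m) X s" by blast
    \<comment> \<open>\<open>T k i\<close> deletes vertex \<open>k\<close> of \<open>s\<close> and
      then cuts at \<open>i\<close>. \<open>P\<close> and \<open>Q\<close> cut first and then delete
      vertex \<open>k\<close> of the front face or of the back face.\<close>
    define P where "P k i = (-1) ^ k * a i (singular_face (Suc i) k (front_face (Suc i) s)) *
      b (m - i) (back_face (Suc i) (m - i) s)" for k i
    define Q where "Q k i = (-1) ^ k * (a i (front_face i s) *
      b (m - i) (singular_face (Suc (m - i)) k (back_face i (Suc (m - i)) s)))" for k i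
    define T where "T k i = (-1) ^ k * (a i (front_face i (singular_face (Suc m) k s)) *
      b (m - i) (back_face i (m - i) (singular_face (Suc m) k s)))" for k i
    have T: "(\<Sum>k\<le>Suc m. T k i) = (\<Sum>k\<le>Suc i. P k i) + (-1) ^ i * (\<Sum>k\<le>Suc (m - i). Q k i)"
      if i: "i \<le> m" for i
    proof -
      have TP: "T k i = P k i" if "k \<le> i" for k
        using that i front_face_singular_face_le[of k i m s] back_face_singular_face_le[of k i "m - i" s]
        by (simp add: T_def P_def)
      have TQ: "T (k + i) i = (-1) ^ i * Q k i" if "0 < k" "k \<le> Suc (m - i)" for k
        using that i front_face_singular_face_gt[of i "k + i" m s]
          back_face_singular_face_gt[of k "m - i" i s]
        by (simp add: T_def Q_def power_add)
      \<comment> \<open>The last face of the front face and the first face of the back face cancel.\<close>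
      have PQ: "P (Suc i) i + (-1) ^ i * Q 0 i = 0"
        using i front_face_singular_face_le[of "Suc i" i m s] back_face_singular_face_gt[of 0 "m - i" i s]
        by (simp add: P_def Q_def)
      have "(\<Sum>k\<le>Suc m. T k i) = (\<Sum>k\<le>i. T k i) + (\<Sum>k\<in>{Suc i..Suc m}. T k i)"
      proof -
        have "{..Suc m} = {..i} \<union> {Suc i..Suc m}" using i by auto
        then show ?thesis by (simp add: sum.union_disjoint del: sum.atMost_Suc)
      qed
      also have "(\<Sum>k\<in>{Suc i..Suc m}. T k i) = (\<Sum>k\<in>{Suc 0..Suc (m - i)}. T (k + i) i)"
        using i by (intro sum.reindex_bij_witness[of _ "\<lambda>k. k + i" "\<lambda>k. k - i"]) auto
      also have "\<dots> = (-1) ^ i * (\<Sum>k\<in>{Suc 0..Suc (m - i)}. Q k i)"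
        unfolding sum_distrib_left by (intro sum.cong) (auto simp: TQ)
      also have "(\<Sum>k\<in>{Suc 0..Suc (m - i)}. Q k i) = (\<Sum>k\<le>Suc (m - i). Q k i) - Q 0 i"
        by (simp add: atMost_atLeast0 sum.atLeast_Suc_atMost)
      finally show ?thesis
        using PQ TP by (simp add: algebra_simps)
    qed
    have "coboundary X (cup X a b) p s = (\<Sum>k\<le>Suc m. \<Sum>i\<le>m. T k i)"
      using s p singular_simplex_singular_face[OF s]
      by (auto simp: coboundary_def cup_def T_def sum_distrib_left simp del: sum.atMost_Suc intro!: sum.cong)
    also have "\<dots> = (\<Sum>i\<le>m. \<Sum>k\<le>Suc m. T k i)"
      by (rule sum.swap)
    also have "\<dots> = (\<Sum>i\<le>m. \<Sum>k\<le>Suc i. P k i) + (\<Sum>i\<le>m. (-1) ^ i * (\<Sum>k\<le>Suc (m - i). Q k i))"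
      by (simp add: T sum.distrib del: sum.atMost_Suc)
    also have "(\<Sum>i\<le>m. \<Sum>k\<le>Suc i. P k i) = cup X (coboundary X a) b p s"
    proof -
      have "cup X (coboundary X a) b p s =
        (\<Sum>i\<le>Suc m. coboundary X a i (front_face i s) * b (Suc m - i) (back_face i (Suc m - i) s))"
        using s p by (simp add: cup_def del: sum.atMost_Suc)
      also have "\<dots> = (\<Sum>i\<le>m. coboundary X a (Suc i) (front_face (Suc i) s) * b (m - i) (back_face (Suc i) (m - i) s))"
        \<comment> \<open>The term \<open>i = 0\<close> drops out since a coboundary vanishes in
          degree 0. For \<open>coboundary X b\<close> below, the term \<open>i = Suc m\<close> drops
          out for the same reason.\<close>
        by (subst sum.atMost_Suc_shift) (simp add: coboundary_def)
      also have "\<dots> = (\<Sum>i\<le>m. \<Sum>k\<le>Suc i. P k i)"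
        using singular_simplex_front_face[OF s]
        by (auto simp: coboundary_def P_def sum_distrib_right simp del: sum.atMost_Suc intro!: sum.cong)
      finally show ?thesis by simp
    qed
    also have "(\<Sum>i\<le>m. (-1) ^ i * (\<Sum>k\<le>Suc (m - i). Q k i)) = cup X (sign_cochain a) (coboundary X b) p s"
    proof -
      have "cup X (sign_cochain a) (coboundary X b) p s =
        (\<Sum>i\<le>m. (-1) ^ i * a i (front_face i s) * coboundary X b (Suc m - i) (back_face i (Suc m - i) s))"
        using s p by (simp add: cup_def sign_cochain_def) (simp add: coboundary_def)
      also have "\<dots> = (\<Sum>i\<le>m. (-1) ^ i * (\<Sum>k\<le>Suc (m - i). Q k i))"
      proof (rule sum.cong[OF refl])
        fix i assume "i \<in> {..m}"
        then have i: "i \<le> m" by simp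
        then have "singular_simplex (Suc (m - i)) X (back_face i (Suc (m - i)) s)"
          using singular_simplex_back_face[of i "Suc (m - i)" X s] s by simp
        then show "(-1) ^ i * a i (front_face i s) * coboundary X b (Suc m - i) (back_face i (Suc m - i) s) =
          (-1) ^ i * (\<Sum>k\<le>Suc (m - i). Q k i)"
          using i by (simp add: coboundary_def Q_def Suc_diff_le sum_distrib_left mult_ac del: sum.atMost_Suc)
      qed
      finally show ?thesis by simp
    qed
    finally show ?thesis by simp
  qed
qed

section \<open>The cohomology algebra\<close>

lemma cocycles_iff: "c \<in> cocycles X \<longleftrightarrow> c \<in> cochains X \<and> coboundary X c = 0"
  by (simp add: cocycles_def zero_fun_def)

lemma coboundaries_subset: "coboundaries X \<subseteq> cocycles X"
  by (auto simp: coboundaries_def cocycles_iff coboundary_coboundary)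

lemma coboundary_mem [intro]: "c \<in> cochains X \<Longrightarrow> coboundary X c \<in> coboundaries X"
  by (simp add: coboundaries_def)

lemma zero_in_coboundaries [simp, intro]: "0 \<in> coboundaries X"
  using coboundary_mem[of 0 X] by simp

lemma add_in_coboundaries:
  "a \<in> coboundaries X \<Longrightarrow> b \<in> coboundaries X \<Longrightarrow> a + b \<in> coboundaries X"
  by (auto simp: coboundaries_def simp flip: coboundary_add)

lemma uminus_in_coboundaries: "a \<in> coboundaries X \<Longrightarrow> - a \<in> coboundaries X"
  by (auto simp: coboundaries_def simp flip: coboundary_uminus)

lemma scale_in_coboundaries: "a \<in> coboundaries X \<Longrightarrow> scale_cochain q a \<in> coboundaries X"
  by (auto simp: coboundaries_def simp flip: coboundary_scale)

text \<open>The degree \<open>k\<close> component of a coboundary is the coboundary of the component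
  one degree lower, and is zero for \<open>k = 0\<close>. Uniqueness of the decomposition into
  degrees depends on this.\<close>

lemma part_in_coboundaries:
  assumes "a \<in> coboundaries X"
  shows "cochain_part k a \<in> coboundaries X"
proof -
  obtain b where b: "a = coboundary X b" "b \<in> cochains X"
    using assms by (auto simp: coboundaries_def)
  show ?thesis
  proof (cases k)
    case 0
    then show ?thesis by (simp add: b part_zero_coboundary)
  next
    case (Suc m)
    then show ?thesis
      using coboundary_mem[of "cochain_part m b" X] b by (simp add: coboundary_part)
  qed
qed

lemma zero_in_cocycles [simp, intro]: "0 \<in> cocycles X"
  by (simp add: cocycles_iff)

lemma one_in_cocycles [simp, intro]: "\<one>\<^bsub>cochain_ring X\<^esub> \<in> cocycles X"
  by (simp add: cocycles_iff coboundary_one)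

lemma add_in_cocycles [simp, intro]:
  "a \<in> cocycles X \<Longrightarrow> b \<in> cocycles X \<Longrightarrow> a + b \<in> cocycles X"
  by (simp add: cocycles_iff coboundary_add)

lemma uminus_in_cocycles [simp, intro]: "a \<in> cocycles X \<Longrightarrow> - a \<in> cocycles X"
  by (simp add: cocycles_iff coboundary_uminus)

lemma sum_in_cocycles: "(\<And>k. k \<in> A \<Longrightarrow> f k \<in> cocycles X) \<Longrightarrow> sum f A \<in> cocycles X"
  by (induction A rule: infinite_finite_induct) auto

lemma scale_zero [simp]: "scale_cochain q 0 = 0"
  by (simp add: scale_cochain_def fun_eq_iff)

lemma scale_in_cocycles [simp, intro]: "a \<in> cocycles X \<Longrightarrow> scale_cochain q a \<in> cocycles X"
  by (simp add: cocycles_iff coboundary_scale)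

lemma part_zero [simp]: "cochain_part k 0 = 0"
  by (simp add: cochain_part_def fun_eq_iff)

lemma part_in_cocycles [simp, intro]: "a \<in> cocycles X \<Longrightarrow> cochain_part k a \<in> cocycles X"
  by (simp add: cocycles_iff coboundary_part)

lemma sign_cochain_zero [simp]: "sign_cochain 0 = 0"
  by (simp add: sign_cochain_def fun_eq_iff)

lemma cup_in_cocycles [simp, intro]:
  "a \<in> cocycles X \<Longrightarrow> b \<in> cocycles X \<Longrightarrow> cup X a b \<in> cocycles X"
  by (simp add: cocycles_iff coboundary_cup)

lemma cup_coboundary_left:
  assumes "a \<in> coboundaries X" "b \<in> cocycles X"
  shows "cup X a b \<in> coboundaries X"
proof -
  obtain c where c: "a = coboundary X c" "c \<in> cochains X"
    using assms by (auto simp: coboundaries_def)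
  have "coboundary X (cup X c b) = cup X a b"
    using assms c by (simp add: coboundary_cup cocycles_iff)
  then show ?thesis
    using c assms coboundary_mem[of "cup X c b" X] by (simp add: cocycles_iff)
qed

lemma sign_sign [simp]: "sign_cochain (sign_cochain a) = a"
  by (simp add: sign_cochain_def fun_eq_iff flip: mult.assoc power_add)

lemma cup_coboundary_right:
  assumes "a \<in> cocycles X" "b \<in> coboundaries X"
  shows "cup X a b \<in> coboundaries X"
proof -
  obtain c where c: "b = coboundary X c" "c \<in> cochains X"
    using assms by (auto simp: coboundaries_def)
  \<comment> \<open>Twisting \<open>a\<close> beforehand cancels the twist in the Leibniz rule, and
    the twisted cochain is again a cocycle.\<close>
  have "coboundary X (cup X (sign_cochain a) c) = cup X a b"
    using assms c by (simp add: coboundary_cup coboundary_sign cocycles_iff)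
  then show ?thesis
    using c assms coboundary_mem[of "cup X (sign_cochain a) c" X] by (simp add: cocycles_iff)
qed

lemma a_inv_cochain_ring:
  assumes "a \<in> cochains X" shows "\<ominus>\<^bsub>cochain_ring X\<^esub> a = - a"
proof -
  interpret ring "cochain_ring X" by (rule ring_cochain_ring)
  show ?thesis using assms minus_equality[of "- a" a] by simp
qed

lemma subring_cocycles: "subring (cocycles X) (cochain_ring X)"
proof -
  interpret ring "cochain_ring X" by (rule ring_cochain_ring)
  show ?thesis
    by (rule subringI) (auto simp: a_inv_cochain_ring cocycles_iff[of _ X] coboundary_uminus
        coboundary_one coboundary_cup coboundary_add)
qed

text \<open>By the Leibniz rule, a cup product with a coboundary is a coboundary when the other
  factor is a cocycle. Hence the ideal lives in the ring of cocycles and not in that of all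
  cochains.\<close>

lemma ideal_coboundaries: "ideal (coboundaries X) ((cochain_ring X)\<lparr>carrier := cocycles X\<rparr>)"
proof -
  interpret ring "cochain_ring X" by (rule ring_cochain_ring)
  let ?Z = "(cochain_ring X)\<lparr>carrier := cocycles X\<rparr>"
  interpret Z: ring ?Z by (rule subring_is_ring[OF subring_cocycles])
  have inv: "\<ominus>\<^bsub>?Z\<^esub> a = - a" if "a \<in> cocycles X" for a
    using that Z.minus_equality[of "- a" a] by simp
  show ?thesis
  proof (rule idealI)
    show "subgroup (coboundaries X) (add_monoid ?Z)"
    proof (rule Z.add.subgroupI)
      fix a assume a: "a \<in> coboundaries X"
      then have "\<ominus>\<^bsub>?Z\<^esub> a = - a"
        using inv[of a] coboundaries_subset by blast
      then show "\<ominus>\<^bsub>?Z\<^esub> a \<in> coboundaries X"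
        using uminus_in_coboundaries[OF a] by simp
    qed (use coboundaries_subset add_in_coboundaries in auto)
  qed (auto simp: Z.ring_axioms cup_coboundary_left cup_coboundary_right)
qed

section \<open>Cohomology classes and their operations on representatives\<close>

lemma coh_class_image: "coh_class X c = (\<lambda>b. b + c) ` coboundaries X"
  by (auto simp: coh_class_def a_r_coset_def r_coset_def)

lemma coh_class_eq_iff: "coh_class X a = coh_class X b \<longleftrightarrow> a - b \<in> coboundaries X"
proof
  assume "coh_class X a = coh_class X b"
  moreover have "a \<in> coh_class X a"
    unfolding coh_class_image by (rule image_eqI[of _ _ 0]) auto
  ultimately show "a - b \<in> coboundaries X"
    by (auto simp: coh_class_image)
next
  assume ab: "a - b \<in> coboundaries X"
  have "coh_class X a \<subseteq> coh_class X b" if "a - b \<in> coboundaries X" for a b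
  proof
    fix x assume "x \<in> coh_class X a"
    then obtain c where c: "x = c + a" "c \<in> coboundaries X"
      by (auto simp: coh_class_image)
    then have "x = (c + (a - b)) + b" "c + (a - b) \<in> coboundaries X"
      using add_in_coboundaries[OF c(2) that] by (simp_all add: add_ac)
    then show "x \<in> coh_class X b"
      unfolding coh_class_image by blast
  qed
  moreover have "b - a \<in> coboundaries X"
    using uminus_in_coboundaries[OF ab] by simp
  ultimately show "coh_class X a = coh_class X b"
    using ab by blast
qed

lemma mem_coh_classE:
  assumes "c \<in> coh_class X a"
  shows "coh_class X c = coh_class X a"
proof -
  obtain b where "c = b + a" "b \<in> coboundaries X"
    using assms by (auto simp: coh_class_image)
  then show ?thesis by (simp add: coh_class_eq_iff)
qed

lemma coh_class_self: "a \<in> coh_class X a"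
  by (auto simp: coh_class_image intro: image_eqI[of _ _ 0])

lemma coset_eq_coh_class:
  "coboundaries X +>\<^bsub>(cochain_ring X)\<lparr>carrier := cocycles X\<rparr>\<^esub> c = coh_class X c"
  by (auto simp: coh_class_image a_r_coset_def r_coset_def)

lemma carrier_coh: "carrier (coh X) = coh_class X ` cocycles X"
  using coset_eq_coh_class[of X, unfolded a_r_coset_def]
  by (auto simp: coh_def coh_ring_def FactRing_def A_RCOSETS_def RCOSETS_def)

lemma coh_class_in_carrier [simp, intro]: "a \<in> cocycles X \<Longrightarrow> coh_class X a \<in> carrier (coh X)"
  by (simp add: carrier_coh)

lemma mult_coh:
  assumes "a \<in> cocycles X" "b \<in> cocycles X"
  shows "coh_class X a \<otimes>\<^bsub>coh X\<^esub> coh_class X b = coh_class X (cup X a b)"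
  using ideal.rcoset_mult_add[OF ideal_coboundaries, of a X b] assms
  by (simp add: coh_def coh_ring_def FactRing_def coset_eq_coh_class)

lemma add_coh:
  assumes "a \<in> cocycles X" "b \<in> cocycles X"
  shows "coh_class X a \<oplus>\<^bsub>coh X\<^esub> coh_class X b = coh_class X (a + b)"
proof -
  interpret ideal "coboundaries X" "(cochain_ring X)\<lparr>carrier := cocycles X\<rparr>"
    by (rule ideal_coboundaries)
  show ?thesis
    using a_rcos_sum[of a b] assms
    by (simp add: coh_def coh_ring_def FactRing_def coset_eq_coh_class)
qed

lemma one_coh: "\<one>\<^bsub>coh X\<^esub> = coh_class X \<one>\<^bsub>cochain_ring X\<^esub>"
  by (simp add: coh_def coh_ring_def FactRing_def coset_eq_coh_class)

lemma zero_coh: "\<zero>\<^bsub>coh X\<^esub> = coh_class X 0"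
  by (auto simp: coh_def coh_ring_def FactRing_def coh_class_image)

lemma scale_add: "scale_cochain q (a + b) = scale_cochain q a + scale_cochain q b"
  by (simp add: scale_cochain_def fun_eq_iff algebra_simps)

lemma scale_diff: "scale_cochain q (a - b) = scale_cochain q a - scale_cochain q b"
  by (simp add: scale_cochain_def fun_eq_iff algebra_simps)

text \<open>The scalar multiple is defined as a union over all representatives. They all yield the
  same coset, since coboundaries are stable under scaling, so the union collapses.\<close>

lemma smult_coh: "q \<odot>\<^bsub>coh X\<^esub> coh_class X a = coh_class X (scale_cochain q a)"
proof -
  have "coh_class X (scale_cochain q c) = coh_class X (scale_cochain q a)" if "c \<in> coh_class X a" for c
    using mem_coh_classE[OF that] scale_in_coboundaries[of "c - a" X q]
    by (simp add: coh_class_eq_iff scale_diff)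
  then have "(\<Union>c\<in>coh_class X a. coh_class X (scale_cochain q c)) = coh_class X (scale_cochain q a)"
    using coh_class_self[of a X] by (intro SUP_eq_const) blast+
  then show ?thesis
    by (simp add: coh_def scale_cochain_def)
qed

text \<open>Homogeneity is expressed as being fixed by the projection \<open>cochain_part k\<close>,
  so that the rules moving this projection through other operations apply.\<close>

lemma grade_coh:
  "grade (coh X) k = {coh_class X c |c. c \<in> cocycles X \<and> cochain_part k c = c}"
proof -
  have "cochain_part k c = c \<longleftrightarrow> (\<forall>p s. p \<noteq> k \<longrightarrow> c p s = 0)" for c :: "'a cochain"
    by (auto simp: cochain_part_def fun_eq_iff)
  then show ?thesis by (simp add: coh_def)
qed

lemma ring_coh: "ring (coh X)"
proof (rule ringI)
  show "abelian_group (coh X)"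
  proof (rule abelian_groupI)
    fix x assume "x \<in> carrier (coh X)"
    then obtain a where a: "x = coh_class X a" "a \<in> cocycles X"
      by (auto simp: carrier_coh)
    then show "\<exists>y\<in>carrier (coh X). y \<oplus>\<^bsub>coh X\<^esub> x = \<zero>\<^bsub>coh X\<^esub>"
      by (intro bexI[of _ "coh_class X (- a)"]) (auto simp: add_coh zero_coh)
  qed (auto simp: carrier_coh add_coh zero_coh add_ac)
  show "Group.monoid (coh X)"
    by (rule monoidI) (auto simp: carrier_coh mult_coh one_coh cup_assoc cocycles_iff[THEN iffD1]
        cup_one_left cup_one_right)
qed (auto simp: carrier_coh mult_coh add_coh cup_add_left cup_add_right)

lemma cring_rat_ring: "cring rat_ring"
proof (rule cringI)
  show "abelian_group rat_ring"
    by (rule abelian_groupI) (auto simp: rat_ring_def intro: exI[of _ "- _"])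
  show "comm_monoid rat_ring"
    by (rule comm_monoidI) (auto simp: rat_ring_def)
qed (auto simp: rat_ring_def algebra_simps)

lemma module_coh: "module rat_ring (coh X)"
proof (rule moduleI)
  show "abelian_group (coh X)"
    using ring_coh by (rule ring.is_abelian_group)
  have "scale_cochain (p + q) a = scale_cochain p a + scale_cochain q a"
    "scale_cochain (p * q) a = scale_cochain p (scale_cochain q a)" "scale_cochain 1 a = a"
    for p q and a :: "'a cochain"
    by (simp_all add: scale_cochain_def fun_eq_iff algebra_simps)
  then show "\<And>p q x. p \<in> carrier rat_ring \<Longrightarrow> q \<in> carrier rat_ring \<Longrightarrow> x \<in> carrier (coh X) \<Longrightarrow>
      (p \<oplus>\<^bsub>rat_ring\<^esub> q) \<odot>\<^bsub>coh X\<^esub> x = p \<odot>\<^bsub>coh X\<^esub> x \<oplus>\<^bsub>coh X\<^esub> q \<odot>\<^bsub>coh X\<^esub> x"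
    "\<And>p q x. p \<in> carrier rat_ring \<Longrightarrow> q \<in> carrier rat_ring \<Longrightarrow> x \<in> carrier (coh X) \<Longrightarrow>
      (p \<otimes>\<^bsub>rat_ring\<^esub> q) \<odot>\<^bsub>coh X\<^esub> x = p \<odot>\<^bsub>coh X\<^esub> (q \<odot>\<^bsub>coh X\<^esub> x)"
    "\<And>x. x \<in> carrier (coh X) \<Longrightarrow> \<one>\<^bsub>rat_ring\<^esub> \<odot>\<^bsub>coh X\<^esub> x = x"
    by (auto simp: rat_ring_def carrier_coh smult_coh add_coh)
qed (auto simp: cring_rat_ring carrier_coh smult_coh add_coh scale_add)

lemma finsum_coh:
  assumes "finite A" "\<And>k. k \<in> A \<Longrightarrow> f k \<in> cocycles X"
  shows "(\<Oplus>\<^bsub>coh X\<^esub>k\<in>A. coh_class X (f k)) = coh_class X (sum f A)"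
proof -
  interpret ring "coh X" by (rule ring_coh)
  show ?thesis using assms
  proof (induction A)
    case empty
    show ?case by (simp only: finsum_empty sum.empty zero_coh)
  next
    case (insert k A)
    then show ?case
      by (subst finsum_insert) (auto simp: add_coh sum_in_cocycles)
  qed
qed

section \<open>Decomposition of cohomology into degrees\<close>

lemma part_part: "cochain_part j (cochain_part k a) = (if j = k then cochain_part k a else 0)"
  by (auto simp: cochain_part_def fun_eq_iff)

lemma part_add: "cochain_part k (a + b) = cochain_part k a + cochain_part k b"
  by (auto simp: cochain_part_def fun_eq_iff)

lemma part_diff: "cochain_part k (a - b) = cochain_part k a - cochain_part k b"
  by (auto simp: cochain_part_def fun_eq_iff)

lemma part_uminus: "cochain_part k (- a) = - cochain_part k a"
  by (auto simp: cochain_part_def fun_eq_iff)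

lemma part_scale: "cochain_part k (scale_cochain q a) = scale_cochain q (cochain_part k a)"
  by (auto simp: cochain_part_def scale_cochain_def fun_eq_iff)

lemma part_sum: "cochain_part k (sum f A) = (\<Sum>j\<in>A. cochain_part k (f j))"
proof (induction A rule: infinite_finite_induct)
  case (infinite A)
  then show ?case by (simp only: sum.infinite[OF infinite.hyps] part_zero)
next
  case empty
  show ?case by (simp only: sum.empty part_zero)
next
  case (insert j A)
  then show ?case by (simp only: sum.insert[OF insert.hyps] part_add)
qed

lemma part_cup:
  assumes "cochain_part i a = a" "cochain_part j b = b"
  shows "cochain_part (i + j) (cup X a b) = cup X a b"
proof -
  have "a m t * b (p - m) u = 0" if "p \<noteq> i + j" "m \<le> p" for m p t u
  proof (cases "m = i")
    case True
    then have "p - m \<noteq> j" using that by linarith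
    then have "cochain_part j b (p - m) u = 0" by (simp add: cochain_part_def)
    then show ?thesis by (simp add: assms)
  next
    case False
    then have "cochain_part i a m t = 0" by (simp add: cochain_part_def)
    then show ?thesis by (simp add: assms)
  qed
  then show ?thesis
    by (auto simp: cup_def cochain_part_def fun_eq_iff intro!: sum.neutral simp del: mult_eq_0_iff)
qed

lemma sum_parts:
  assumes "finite A" "\<And>p s. p \<notin> A \<Longrightarrow> c p s = 0"
  shows "(\<Sum>k\<in>A. cochain_part k c) = c"
proof (intro ext)
  fix p s
  have "(\<Sum>k\<in>A. cochain_part k c) p s = (\<Sum>k\<in>A. if p = k then c p s else 0)"
    by (simp add: sum_cochain_apply cochain_part_def)
  then show "(\<Sum>k\<in>A. cochain_part k c) p s = c p s"
    using assms by simp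
qed

text \<open>The components of a cocycle are cocycles, which gives existence. For uniqueness,
  \<open>e\<close> differs from a sum of homogeneous representatives by a coboundary, and the degree
  \<open>j\<close> component of that coboundary is again one.\<close>

lemma hom_decomp_coh_iff:
  assumes e: "e \<in> cocycles X"
  shows "hom_decomp (coh X) (coh_class X e) c \<longleftrightarrow> c = (\<lambda>k. coh_class X (cochain_part k e))"
proof
  interpret ring "coh X" by (rule ring_coh)
  let ?d = "\<lambda>k. coh_class X (cochain_part k e)"
  {
    assume c: "hom_decomp (coh X) (coh_class X e) c"
    define F where "F = {k. c k \<noteq> \<zero>\<^bsub>coh X\<^esub>}"
    have "\<exists>g. \<forall>k. c k = coh_class X (g k) \<and> g k \<in> cocycles X \<and> cochain_part k (g k) = g k"
      using c by (intro choice) (auto simp: hom_decomp_def grade_coh)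
    then obtain g where g: "\<And>k. c k = coh_class X (g k)" "\<And>k. g k \<in> cocycles X"
      "\<And>k. cochain_part k (g k) = g k" by blast
    have F: "finite F" using c by (simp add: hom_decomp_def F_def)
    have "coh_class X e = coh_class X (sum g F)"
      using c finsum_coh[OF F, of g X] g by (simp add: hom_decomp_def F_def)
    then have B: "e - sum g F \<in> coboundaries X" by (simp add: coh_class_eq_iff)
    have part_g: "cochain_part j (g k) = (if j = k then g k else 0)" for j k
      using part_part[of j k "g k"] by (simp add: g)
    show "c = ?d"
    proof
      fix j
      have "cochain_part j (sum g F) = (if j \<in> F then g j else 0)"
        using F by (simp add: part_sum part_g)
      then have "cochain_part j e - (if j \<in> F then g j else 0) \<in> coboundaries X"
        using part_in_coboundaries[OF B, of j] by (simp add: part_diff)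
      then have "?d j = coh_class X (if j \<in> F then g j else 0)"
        by (simp add: coh_class_eq_iff)
      then show "c j = ?d j"
        by (auto simp: F_def g(1)[symmetric] zero_coh split: if_splits)
    qed
  next
    assume c: "c = ?d"
    define F where "F = {k. ?d k \<noteq> \<zero>\<^bsub>coh X\<^esub>}"
    obtain A where A: "finite A" "\<And>p s. p \<notin> A \<Longrightarrow> e p s = 0"
      using cochains_degrees[of e X] e by (auto simp: cocycles_iff)
    have "cochain_part k e = 0" if "k \<notin> A" for k
      using A(2)[OF that] by (auto simp: cochain_part_def fun_eq_iff)
    then have F: "F \<subseteq> A" by (auto simp: F_def zero_coh)
    \<comment> \<open>A nonzero component of \<open>e\<close> may be exact, so \<open>F\<close> can
      be smaller than \<open>A\<close>; the terms added here are zero classes.\<close>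
    have "(\<Oplus>\<^bsub>coh X\<^esub>k\<in>F. ?d k) = (\<Oplus>\<^bsub>coh X\<^esub>k\<in>A. ?d k)"
      using F A e by (intro add.finprod_mono_neutral_cong_left) (auto simp: F_def)
    also have "\<dots> = coh_class X e"
      using A e by (simp add: finsum_coh sum_parts)
    finally show "hom_decomp (coh X) (coh_class X e) c"
      using e F A finite_subset[OF F] unfolding c hom_decomp_def F_def[symmetric]
      by (auto simp: grade_coh part_part intro!: exI[of _ "cochain_part _ e"])
  }
qed

lemma submodule_grade_coh: "submodule (grade (coh X) k) rat_ring (coh X)"
proof -
  interpret module rat_ring "coh X" by (rule module_coh)
  have inv: "\<ominus>\<^bsub>coh X\<^esub> coh_class X a = coh_class X (- a)" if "a \<in> cocycles X" for a
    using that minus_equality[of "coh_class X (- a)" "coh_class X a"] by (simp add: add_coh zero_coh)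
  show ?thesis
  proof (rule submoduleI)
    show "\<zero>\<^bsub>coh X\<^esub> \<in> grade (coh X) k"
      unfolding grade_coh zero_coh by force
    show "\<And>a. a \<in> grade (coh X) k \<Longrightarrow> \<ominus>\<^bsub>coh X\<^esub> a \<in> grade (coh X) k"
      unfolding grade_coh by (force simp: inv part_uminus)
    show "\<And>a b. a \<in> grade (coh X) k \<Longrightarrow> b \<in> grade (coh X) k \<Longrightarrow> a \<oplus>\<^bsub>coh X\<^esub> b \<in> grade (coh X) k"
      unfolding grade_coh by (force simp: add_coh part_add)
    show "\<And>q a. a \<in> grade (coh X) k \<Longrightarrow> q \<odot>\<^bsub>coh X\<^esub> a \<in> grade (coh X) k"
      unfolding grade_coh by (force simp: smult_coh part_scale)
  qed (auto simp: grade_coh)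
qed

lemma graded_algebra_coh: "graded_algebra (coh X)"
  unfolding graded_algebra_def
proof (intro conjI allI ballI)
  show "\<one>\<^bsub>coh X\<^esub> \<in> grade (coh X) 0"
    by (auto simp: grade_coh one_coh cochain_part_def one_cochain_apply fun_eq_iff
        intro!: exI[of _ "\<one>\<^bsub>cochain_ring X\<^esub>"])
next
  fix i j x y assume "x \<in> grade (coh X) i" "y \<in> grade (coh X) j"
  then show "x \<otimes>\<^bsub>coh X\<^esub> y \<in> grade (coh X) (i + j)"
    by (force simp: grade_coh mult_coh part_cup)
next
  fix x assume "x \<in> carrier (coh X)"
  then show "\<exists>!c. hom_decomp (coh X) x c"
    by (auto simp: carrier_coh hom_decomp_coh_iff)
qed (auto simp: ring_coh module_coh submodule_grade_coh carrier_coh smult_coh mult_coh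
    cup_scale_left cup_scale_right)

section \<open>Pullbacks\<close>

lemma singular_face_simplex_map_commute:
  assumes "0 < p" "k \<le> p"
  shows "singular_face p k (simplex_map p f s) = simplex_map (p - 1) f (singular_face p k s)"
proof -
  have "simplical_face k t \<in> standard_simplex p" if "t \<in> standard_simplex (p - Suc 0)" for t
    using simplical_face_in_standard_simplex[of p k t] that assms by simp
  then show ?thesis
    by (auto simp: singular_face_def simplex_map_def restrict_def intro!: ext)
qed

lemma front_face_simplex_map:
  assumes "i \<le> p"
  shows "front_face i (simplex_map p f s) = simplex_map i f (front_face i s)"
  using standard_simplex_mono[OF assms]
  by (auto simp: front_face_def simplex_map_def restrict_def intro!: ext)

lemma back_face_simplex_map:
  "back_face i q (simplex_map (i + q) f s) = simplex_map q f (back_face i q s)"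
  using shift_point_in_standard_simplex[of _ q i]
  by (auto simp: back_face_eq simplex_map_def restrict_def intro!: ext)

lemma pullback_add:
  "cochain_pullback X f (a + b) = cochain_pullback X f a + cochain_pullback X f b"
  by (auto simp: cochain_pullback_def fun_eq_iff)

lemma pullback_diff:
  "cochain_pullback X f (a - b) = cochain_pullback X f a - cochain_pullback X f b"
  by (auto simp: cochain_pullback_def fun_eq_iff)

lemma pullback_zero [simp]: "cochain_pullback X f 0 = 0"
  by (auto simp: cochain_pullback_def fun_eq_iff)

lemma pullback_scale:
  "cochain_pullback X f (scale_cochain q a) = scale_cochain q (cochain_pullback X f a)"
  by (auto simp: cochain_pullback_def scale_cochain_def fun_eq_iff)

lemma pullback_part:
  "cochain_pullback X f (cochain_part k a) = cochain_part k (cochain_pullback X f a)"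
  by (auto simp: cochain_pullback_def cochain_part_def fun_eq_iff)

lemma pullback_in_cochains:
  assumes "c \<in> cochains Y"
  shows "cochain_pullback X f c \<in> cochains X"
proof -
  obtain A where A: "finite A" "\<And>p s. p \<notin> A \<Longrightarrow> c p s = 0"
    using cochains_degrees[OF assms] by blast
  show ?thesis
    by (rule mem_cochainsI[OF _ A(1)]) (simp_all add: A cochain_pullback_def)
qed

context
  fixes X :: "'x topology" and Y :: "'y topology" and f :: "'x \<Rightarrow> 'y"
  assumes f: "continuous_map X Y f"
begin

text \<open>Continuity enters here: it makes the guards in the definitions of the unit, the
  coboundary and the cup product on \<open>Y\<close> hold whenever those on \<open>X\<close>
  do.\<close>

lemma singular_simplex_map: "singular_simplex p X s \<Longrightarrow> singular_simplex p Y (simplex_map p f s)"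
  by (rule singular_simplex_simplex_map[OF _ f])

lemma pullback_one: "cochain_pullback X f \<one>\<^bsub>cochain_ring Y\<^esub> = \<one>\<^bsub>cochain_ring X\<^esub>"
  by (auto simp: cochain_pullback_def fun_eq_iff one_cochain_apply singular_simplex_map)

lemma pullback_coboundary:
  "cochain_pullback X f (coboundary Y c) = coboundary X (cochain_pullback X f c)"
proof (intro ext)
  fix p s
  show "cochain_pullback X f (coboundary Y c) p s = coboundary X (cochain_pullback X f c) p s"
  proof (cases "singular_simplex p X s \<and> 0 < p")
    case True
    then have "singular_simplex (p - 1) X (singular_face p k s)" if "k \<le> p" for k
      using singular_simplex_singular_face[of p X s k] that by simp
    then show ?thesis
      using True
      by (auto simp: cochain_pullback_def coboundary_def singular_simplex_map
          singular_face_simplex_map_commute intro!: sum.cong)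
  qed (auto simp: cochain_pullback_def coboundary_def)
qed

lemma pullback_cup:
  "cochain_pullback X f (cup Y a b) = cup X (cochain_pullback X f a) (cochain_pullback X f b)"
proof (intro ext)
  fix p s
  show "cochain_pullback X f (cup Y a b) p s =
    cup X (cochain_pullback X f a) (cochain_pullback X f b) p s"
  proof (cases "singular_simplex p X s")
    case True
    have "front_face i (simplex_map p f s) = simplex_map i f (front_face i s)"
      "back_face i (p - i) (simplex_map p f s) = simplex_map (p - i) f (back_face i (p - i) s)"
      "singular_simplex i X (front_face i s)" "singular_simplex (p - i) X (back_face i (p - i) s)"
      if "i \<le> p" for i
      using that front_face_simplex_map[of i p f s] back_face_simplex_map[of i "p - i" f s]
        singular_simplex_front_face[OF True that] singular_simplex_back_face[of i "p - i" X s] True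
      by simp_all
    then show ?thesis
      using True by (simp add: cochain_pullback_def cup_def singular_simplex_map)
  qed (auto simp: cochain_pullback_def cup_def)
qed

lemma pullback_in_cocycles [simp, intro]:
  "c \<in> cocycles Y \<Longrightarrow> cochain_pullback X f c \<in> cocycles X"
  by (auto simp: cocycles_iff pullback_in_cochains simp flip: pullback_coboundary)

lemma pullback_in_coboundaries:
  "c \<in> coboundaries Y \<Longrightarrow> cochain_pullback X f c \<in> coboundaries X"
  by (auto simp: coboundaries_def pullback_coboundary intro!: imageI pullback_in_cochains)

text \<open>All representatives pull back to cohomologous cocycles, so the union in
  \<open>coh_map\<close> is a single coset.\<close>

lemma coh_map_class:
  assumes "c \<in> cocycles Y"
  shows "coh_map X Y f (coh_class Y c) = coh_class X (cochain_pullback X f c)"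
proof -
  have "coh_class X (cochain_pullback X f d) = coh_class X (cochain_pullback X f c)"
    if "d \<in> coh_class Y c" for d
    using mem_coh_classE[OF that] pullback_in_coboundaries[of "d - c"]
    by (simp add: coh_class_eq_iff pullback_diff)
  then have "(\<Union>d\<in>coh_class Y c. coh_class X (cochain_pullback X f d)) =
      coh_class X (cochain_pullback X f c)"
    using coh_class_self[of c Y] by (intro SUP_eq_const) blast+
  then show ?thesis
    using assms by (simp add: coh_map_def)
qed

lemma coh_map_in_carrier: "K \<in> carrier (coh Y) \<Longrightarrow> coh_map X Y f K \<in> carrier (coh X)"
  by (auto simp: carrier_coh coh_map_class)

end

text \<open>Both spaces have points of one type because \<open>galg_hom\<close> relates algebras
  with elements of one type. Maps into the Grassmannian change the type and are covered by
  \<open>coh_map_in_carrier\<close> and \<open>coh_map_compose\<close>.\<close>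

lemma coh_map_in_galg_hom:
  fixes X Y :: "'x topology"
  assumes f: "continuous_map X Y f"
  shows "coh_map X Y f \<in> galg_hom (coh Y) (coh X)"
  unfolding galg_hom_def
proof (intro CollectI conjI allI ballI)
  show "coh_map X Y f \<in> ring_hom (coh Y) (coh X)"
    using f by (intro ring_hom_memI)
      (auto simp: carrier_coh coh_map_class[OF f] mult_coh add_coh one_coh pullback_cup[OF f] pullback_add pullback_one[OF f])
  show "coh_map X Y f \<in> extensional (carrier (coh Y))"
    by (simp add: coh_map_def)
next
  fix q x assume "x \<in> carrier (coh Y)"
  then show "coh_map X Y f (q \<odot>\<^bsub>coh Y\<^esub> x) = q \<odot>\<^bsub>coh X\<^esub> coh_map X Y f x"
    using f by (auto simp: carrier_coh coh_map_class[OF f] smult_coh pullback_scale)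
next
  fix k show "coh_map X Y f ` grade (coh Y) k \<subseteq> grade (coh X) k"
    using f by (force simp: grade_coh coh_map_class[OF f] simp flip: pullback_part)
qed

text \<open>Agreement with the identity on \<open>topspace X\<close> suffices since simplices take
  values there. The identity of a graph induces a map of this kind: it fixes just those tuples that
  are \<open>undefined\<close> off the vertices.\<close>

lemma coh_map_id:
  assumes "\<And>x. x \<in> topspace X \<Longrightarrow> f x = x"
  shows "coh_map X X f = (\<lambda>x\<in>carrier (coh X). x)"
proof (intro ext)
  have f: "continuous_map X X f"
    using continuous_map_eq[OF continuous_map_id[of X]] assms by fastforce
  have "cochain_pullback X f c = c" if "c \<in> cochains X" for c
  proof -
    have "simplex_map p f s = s" if "singular_simplex p X s" for p s
      using that assms by (rule simplex_map_id_gen)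
    then show ?thesis
      using cochains_zero[OF that] by (intro ext) (simp add: cochain_pullback_def)
  qed
  then show "coh_map X X f K = (\<lambda>x\<in>carrier (coh X). x) K" for K
    by (cases "K \<in> carrier (coh X)")
      (auto simp: carrier_coh coh_map_class[OF f] cocycles_iff[THEN iffD1], simp_all add: coh_map_def carrier_coh)
qed

lemma coh_map_compose:
  assumes f: "continuous_map X Y f" and g: "continuous_map Y Z g"
  shows "coh_map X Z (g \<circ> f) = compose (carrier (coh Z)) (coh_map X Y f) (coh_map Y Z g)"
proof (intro ext)
  fix K
  have gf: "continuous_map X Z (g \<circ> f)"
    using f g by (rule continuous_map_compose)
  have "cochain_pullback X (g \<circ> f) c = cochain_pullback X f (cochain_pullback Y g c)" for c
    by (auto simp: cochain_pullback_def fun_eq_iff simplex_map_compose singular_simplex_map[OF f])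
  then show "coh_map X Z (g \<circ> f) K = compose (carrier (coh Z)) (coh_map X Y f) (coh_map Y Z g) K"
    by (cases "K \<in> carrier (coh Z)")
      (auto simp: carrier_coh coh_map_class[OF f] coh_map_class[OF g] coh_map_class[OF gf]
        pullback_in_cocycles[OF g] compose_def, simp_all add: coh_map_def carrier_coh)
qed

section \<open>Graded algebras\<close>

lemma graded_algebraD:
  assumes "graded_algebra A"
  shows "ring A" "module rat_ring A"
    "\<And>q x y. x \<in> carrier A \<Longrightarrow> y \<in> carrier A \<Longrightarrow> (q \<odot>\<^bsub>A\<^esub> x) \<otimes>\<^bsub>A\<^esub> y = q \<odot>\<^bsub>A\<^esub> (x \<otimes>\<^bsub>A\<^esub> y)"
    "\<And>q x y. x \<in> carrier A \<Longrightarrow> y \<in> carrier A \<Longrightarrow> x \<otimes>\<^bsub>A\<^esub> (q \<odot>\<^bsub>A\<^esub> y) = q \<odot>\<^bsub>A\<^esub> (x \<otimes>\<^bsub>A\<^esub> y)"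
    "\<And>k. submodule (grade A k) rat_ring A"
    "\<And>k. grade A k \<subseteq> carrier A"
    "\<one>\<^bsub>A\<^esub> \<in> grade A 0"
    "\<And>i j x y. x \<in> grade A i \<Longrightarrow> y \<in> grade A j \<Longrightarrow> x \<otimes>\<^bsub>A\<^esub> y \<in> grade A (i + j)"
    "\<And>x. x \<in> carrier A \<Longrightarrow> \<exists>!c. hom_decomp A x c"
proof -
  show sub: "submodule (grade A k) rat_ring A" for k
    using assms by (simp add: graded_algebra_def)
  show "grade A k \<subseteq> carrier A" for k
    using submodule.axioms(1)[OF sub[of k]] subgroup.subset by fastforce
qed (use assms in \<open>auto simp: graded_algebra_def\<close>)

lemma carrier_rat_ring [simp]: "carrier rat_ring = UNIV"
  by (simp add: rat_ring_def)

lemma smult_in_carrier: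
  assumes "graded_algebra A" "x \<in> carrier A"
  shows "q \<odot>\<^bsub>A\<^esub> x \<in> carrier A"
  using module.smult_closed[OF graded_algebraD(2)[OF assms(1)], of q x] assms by simp

lemma galg_homD:
  assumes "f \<in> galg_hom A B"
  shows "f \<in> ring_hom A B" "f \<in> extensional (carrier A)"
    "\<And>q x. x \<in> carrier A \<Longrightarrow> f (q \<odot>\<^bsub>A\<^esub> x) = q \<odot>\<^bsub>B\<^esub> f x"
    "\<And>k x. x \<in> grade A k \<Longrightarrow> f x \<in> grade B k"
    "\<And>x. x \<in> carrier A \<Longrightarrow> f x \<in> carrier B"
  using assms ring_hom_memE(1)[of f A B] by (simp_all add: galg_hom_def image_subset_iff)

lemma ring_hom_finsum:
  assumes "ring A" "ring B" "f \<in> ring_hom A B" "finite F" "c \<in> F \<rightarrow> carrier A"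
  shows "f (\<Oplus>\<^bsub>A\<^esub>k\<in>F. c k) = (\<Oplus>\<^bsub>B\<^esub>k\<in>F. f (c k))"
proof -
  interpret ring_hom_ring A B f
    using assms(1-3) by (rule ring_hom_ringI2)
  show ?thesis
    using assms(4,5) by (induction F) (auto simp: R.finsum_insert S.finsum_insert Pi_iff)
qed

lemma hom_decomp_hom:
  assumes A: "graded_algebra A" and B: "graded_algebra B" and f: "f \<in> galg_hom A B"
    and x: "hom_decomp A x c"
  shows "hom_decomp B (f x) (\<lambda>k. f (c k))"
proof -
  interpret ring_hom_ring A B f
    using graded_algebraD(1)[OF A] graded_algebraD(1)[OF B] galg_homD(1)[OF f] by (rule ring_hom_ringI2)
  define F where "F = {k. c k \<noteq> \<zero>\<^bsub>A\<^esub>}"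
  have F: "finite F" and xF: "x = (\<Oplus>\<^bsub>A\<^esub>k\<in>F. c k)" and c: "\<And>k. c k \<in> grade A k"
    using x by (auto simp: hom_decomp_def F_def)
  have cA: "c k \<in> carrier A" for k
    using c graded_algebraD(6)[OF A] by blast
  \<comment> \<open>\<open>f\<close> may kill components, so the support of the decomposition can
    shrink.\<close>
  have sub: "{k. f (c k) \<noteq> \<zero>\<^bsub>B\<^esub>} \<subseteq> F"
    by (auto simp: F_def)
  have "f x = (\<Oplus>\<^bsub>B\<^esub>k\<in>F. f (c k))"
    unfolding xF using F cA by (intro ring_hom_finsum R.ring_axioms S.ring_axioms homh) auto
  also have "\<dots> = (\<Oplus>\<^bsub>B\<^esub>k\<in>{k. f (c k) \<noteq> \<zero>\<^bsub>B\<^esub>}. f (c k))"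
    using sub F cA by (intro S.add.finprod_mono_neutral_cong_right) auto
  finally show ?thesis
    using finite_subset[OF sub F] galg_homD(4)[OF f c] by (simp add: hom_decomp_def)
qed

section \<open>Graded subalgebras and generation\<close>

lemma graded_subalgebra_subset: "graded_subalgebra S A \<Longrightarrow> S \<subseteq> carrier A"
  by (auto simp: graded_subalgebra_def dest: subringE(1))

text \<open>Makes the family intersected in \<open>generated_galg\<close> nonempty, so that the
  intersection stays inside the carrier.\<close>

lemma graded_subalgebra_carrier:
  assumes "graded_algebra A"
  shows "graded_subalgebra (carrier A) A"
  using ring.carrier_is_subring[OF graded_algebraD(1)[OF assms]] smult_in_carrier[OF assms]
    graded_algebraD(6)[OF assms]
  unfolding graded_subalgebra_def hom_decomp_def by blast

lemma generated_galg_superset: "X \<subseteq> generated_galg A X"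
  by (auto simp: generated_galg_def)

lemma generated_galg_least:
  "graded_subalgebra S A \<Longrightarrow> X \<subseteq> S \<Longrightarrow> generated_galg A X \<subseteq> S"
  by (auto simp: generated_galg_def)

lemma graded_subalgebra_generated:
  assumes "graded_algebra A" "X \<subseteq> carrier A"
  shows "graded_subalgebra (generated_galg A X) A"
proof -
  interpret ring A by (rule graded_algebraD(1)[OF assms(1)])
  have "subring (generated_galg A X) A"
    unfolding generated_galg_def
    using graded_subalgebra_carrier[OF assms(1)] assms(2)
    by (intro subring_Inter) (auto simp: graded_subalgebra_def)
  then show ?thesis
    unfolding graded_subalgebra_def generated_galg_def by blast
qed

text \<open>Closure under components holds because \<open>f\<close> carries the decomposition of
  \<open>x\<close> to that of \<open>f x\<close>, whose components lie in \<open>T\<close>.\<close>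

lemma graded_subalgebra_preimage:
  assumes A: "graded_algebra A" and B: "graded_algebra B" and f: "f \<in> galg_hom A B"
    and T: "graded_subalgebra T B"
  shows "graded_subalgebra {x \<in> carrier A. f x \<in> T} A"
proof -
  interpret ring_hom_ring A B f
    using graded_algebraD(1)[OF A] graded_algebraD(1)[OF B] galg_homD(1)[OF f] by (rule ring_hom_ringI2)
  have sub: "subring T B" and smult: "\<And>q x. x \<in> T \<Longrightarrow> q \<odot>\<^bsub>B\<^esub> x \<in> T"
    and decomp: "\<And>x c k. x \<in> T \<Longrightarrow> hom_decomp B x c \<Longrightarrow> c k \<in> T"
    using T by (auto simp: graded_subalgebra_def)
  have "subring {x \<in> carrier A. f x \<in> T} A"
    using subringE[OF sub] by (intro R.subringI) auto
  moreover have "c k \<in> carrier A" if "hom_decomp A x c" for x c k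
    using that graded_algebraD(6)[OF A] by (auto simp: hom_decomp_def)
  ultimately show ?thesis
    using smult decomp hom_decomp_hom[OF A B f] smult_in_carrier[OF A] galg_homD(3)[OF f]
    unfolding graded_subalgebra_def by auto blast
qed

text \<open>The preimage of the right-hand algebra is a graded subalgebra containing
  \<open>X\<close>, hence one of those intersected to form
  \<open>generated_galg A X\<close>.\<close>

lemma galg_hom_generated:
  assumes "graded_algebra A" "graded_algebra B" "f \<in> galg_hom A B"
    and "X \<subseteq> carrier A" "Y \<subseteq> carrier B" "f ` X \<subseteq> generated_galg B Y"
  shows "f ` generated_galg A X \<subseteq> generated_galg B Y"
proof -
  have "generated_galg A X \<subseteq> {x \<in> carrier A. f x \<in> generated_galg B Y}"
    using assms generated_galg_superset[of X A] graded_subalgebra_generated[OF assms(2,5)]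
    by (intro generated_galg_least graded_subalgebra_preimage) auto
  then show ?thesis by auto
qed

section \<open>Restriction to a graded subalgebra\<close>

lemma restrict_galg_simps [simp]:
  "carrier (restrict_galg A S) = S" "mult (restrict_galg A S) = mult A"
  "one (restrict_galg A S) = one A" "zero (restrict_galg A S) = zero A"
  "add (restrict_galg A S) = add A" "smult (restrict_galg A S) = smult A"
  "grade (restrict_galg A S) k = grade A k \<inter> S"
  by (simp_all add: restrict_galg_def)

lemma ring_restrict_galg:
  assumes "ring A" "subring S A"
  shows "ring (restrict_galg A S)"
proof -
  interpret ring A by fact
  note S = subringE[OF assms(2)]
  have sub: "x \<in> carrier A" if "x \<in> S" for x
    using that S(1) by blast
  show ?thesis
  proof (rule ringI)
    show "abelian_group (restrict_galg A S)"
    proof (rule abelian_groupI)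
      fix x assume "x \<in> carrier (restrict_galg A S)"
      then show "\<exists>y\<in>carrier (restrict_galg A S).
          y \<oplus>\<^bsub>restrict_galg A S\<^esub> x = \<zero>\<^bsub>restrict_galg A S\<^esub>"
        using S(5) l_neg[OF sub] by (intro bexI[of _ "\<ominus>\<^bsub>A\<^esub> x"]) simp_all
    qed (simp_all add: sub S(2,7) a_assoc, simp add: sub a_comm)
    show "Group.monoid (restrict_galg A S)"
      by (rule monoidI) (simp_all add: sub S(3,6) m_assoc)
  qed (simp_all add: sub l_distr r_distr)
qed

text \<open>\<open>finsum\<close> depends on the carrier of its structure, so the agreement of the
  two sums is a matter of induction.\<close>

lemma finsum_restrict_galg:
  assumes "ring A" "subring S A" "finite F" "c \<in> F \<rightarrow> S"
  shows "(\<Oplus>\<^bsub>restrict_galg A S\<^esub>k\<in>F. c k) = (\<Oplus>\<^bsub>A\<^esub>k\<in>F. c k)"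
proof -
  interpret ring A by fact
  interpret S: ring "restrict_galg A S" using assms(1,2) by (rule ring_restrict_galg)
  have "c k \<in> carrier A" if "k \<in> F" for k
    using that assms(4) subringE(1)[OF assms(2)] by auto
  with assms(3,4) show ?thesis
    by (induction rule: finite_induct) (auto simp: finsum_insert S.finsum_insert Pi_iff)
qed

lemma graded_algebra_restrict_galg:
  assumes A: "graded_algebra A" and S: "graded_subalgebra S A"
  shows "graded_algebra (restrict_galg A S)"
proof -
  have sub: "subring S A" and smult: "\<And>q x. x \<in> S \<Longrightarrow> q \<odot>\<^bsub>A\<^esub> x \<in> S"
    and decomp: "\<And>x c k. x \<in> S \<Longrightarrow> hom_decomp A x c \<Longrightarrow> c k \<in> S"
    using S by (auto simp: graded_subalgebra_def)
  have S_sub: "x \<in> carrier A" if "x \<in> S" for x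
    using that graded_subalgebra_subset[OF S] by blast
  interpret A: module rat_ring A by (rule graded_algebraD(2)[OF A])
  interpret A: ring A by (rule graded_algebraD(1)[OF A])
  interpret R: ring "restrict_galg A S" by (rule ring_restrict_galg[OF A.ring_axioms sub])
  interpret R: module rat_ring "restrict_galg A S"
    using A.smult_l_distr A.smult_r_distr A.smult_assoc1 A.smult_one S_sub smult
    by (intro moduleI cring_rat_ring R.is_abelian_group) auto
  have inv: "\<ominus>\<^bsub>restrict_galg A S\<^esub> x = \<ominus>\<^bsub>A\<^esub> x" if "x \<in> S" for x
    using R.minus_equality[of "\<ominus>\<^bsub>A\<^esub> x" x] that subringE(5)[OF sub] A.l_neg[OF S_sub] by simp
  \<comment> \<open>The components of an element of \<open>S\<close> lie in \<open>S\<close> by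
    gradedness, so existence and uniqueness of decompositions are inherited from
    \<open>A\<close>.\<close>
  have decomp_iff: "hom_decomp (restrict_galg A S) x c \<longleftrightarrow> hom_decomp A x c" if "x \<in> S" for x c
  proof -
    have "finsum (restrict_galg A S) c {k. c k \<noteq> \<zero>\<^bsub>A\<^esub>} = finsum A c {k. c k \<noteq> \<zero>\<^bsub>A\<^esub>}"
      if "\<And>k. c k \<in> S" "finite {k. c k \<noteq> \<zero>\<^bsub>A\<^esub>}"
      using finsum_restrict_galg[OF A.ring_axioms sub that(2), of c] that(1) by simp
    then show ?thesis
      using decomp[OF \<open>x \<in> S\<close>, of c] by (auto simp: hom_decomp_def)
  qed
  show ?thesis
    unfolding graded_algebra_def
  proof (intro conjI allI ballI)
    fix k
    have g: "submodule (grade A k) rat_ring A" by (rule graded_algebraD(5)[OF A])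
    show "submodule (grade (restrict_galg A S) k) rat_ring (restrict_galg A S)"
      using A.submoduleE[OF g] subgroup.one_closed[OF submodule.axioms(1)[OF g]] subringE[OF sub] inv smult
      by (intro R.submoduleI) auto
  next
    fix x assume "x \<in> carrier (restrict_galg A S)"
    then show "\<exists>!c. hom_decomp (restrict_galg A S) x c"
      using graded_algebraD(9)[OF A] S_sub by (simp add: decomp_iff)
  qed (use graded_algebraD(3,4,7,8)[OF A] S_sub subringE[OF sub] R.ring_axioms R.module_axioms in auto)
qed

lemma galg_hom_restrict:
  assumes f: "f \<in> galg_hom A B" and "f ` S \<subseteq> T"
    and S: "graded_subalgebra S A"
  shows "restrict f S \<in> galg_hom (restrict_galg A S) (restrict_galg B T)"
proof -
  have sub: "subring S A" and smult: "\<And>q x. x \<in> S \<Longrightarrow> q \<odot>\<^bsub>A\<^esub> x \<in> S"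
    using S by (auto simp: graded_subalgebra_def)
  have "restrict f S \<in> ring_hom (restrict_galg A S) (restrict_galg B T)"
    using galg_homD(1)[OF f] assms subringE[OF sub]
    by (intro ring_hom_memI) (auto simp: ring_hom_def subset_iff)
  then show ?thesis
    using assms smult galg_homD(3,4)[OF f] subringE(1)[OF sub] by (auto simp: galg_hom_def)
qed

lemma galg_hom_id: "(\<lambda>x\<in>carrier A. x) \<in> galg_hom A A" if "graded_algebra A"
proof -
  interpret ring A by (rule graded_algebraD(1)[OF that])
  show ?thesis
    using graded_algebraD(6)[OF that] smult_in_carrier[OF that]
    by (auto simp: galg_hom_def ring_hom_def)
qed

lemma galg_hom_compose:
  assumes A: "graded_algebra A" and f: "f \<in> galg_hom A B" and g: "g \<in> galg_hom B C"
  shows "compose (carrier A) g f \<in> galg_hom A C"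
proof -
  interpret ring A by (rule graded_algebraD(1)[OF A])
  have "compose (carrier A) g f \<in> ring_hom A C"
    using galg_homD(1)[OF f] galg_homD(1)[OF g]
    by (intro ring_hom_memI) (auto simp: ring_hom_def compose_def Pi_iff)
  then show ?thesis
    using galg_homD(3-5)[OF f] galg_homD(3-5)[OF g] graded_algebraD(6)[OF A] smult_in_carrier[OF A]
    by (auto simp: galg_hom_def compose_def subset_iff)
qed

lemma galg_hom_PiE: "f \<in> galg_hom A B \<Longrightarrow> f \<in> carrier A \<rightarrow>\<^sub>E carrier B"
  using galg_homD(2,5) by (auto simp: PiE_def)

lemma galg_hom_funcset: "f \<in> galg_hom A B \<Longrightarrow> f \<in> carrier A \<rightarrow> carrier B"
  by (simp add: galg_homD(5))

lemma compose_restrict_id: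
  assumes "f \<in> A \<rightarrow>\<^sub>E B"
  shows "compose A f (\<lambda>x\<in>A. x) = f" "compose A (\<lambda>x\<in>B. x) f = f"
  using assms by (auto simp: compose_def fun_eq_iff PiE_def extensional_def restrict_def)

section \<open>Categories\<close>

lemma is_category_galg_cat: "is_category (galg_cat :: ('h galg, 'h \<Rightarrow> 'h) cat)"
  unfolding is_category_def galg_cat_def
  by (auto simp: galg_hom_id compose_restrict_id[OF galg_hom_PiE]
      intro: compose_assoc[OF galg_hom_funcset] galg_hom_compose)

lemma galg_pair_cat_simps:
  "cat_ob galg_pair_cat = {P. graded_algebra (fst P) \<and> graded_subalgebra (snd P) (fst P)}"
  "f \<in> cat_hom galg_pair_cat P Q \<longleftrightarrow> f \<in> galg_hom (fst P) (fst Q) \<and> f ` snd P \<subseteq> snd Q"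
  "cat_id galg_pair_cat P = (\<lambda>x\<in>carrier (fst P). x)"
  "cat_comp galg_pair_cat P Q R g f = compose (carrier (fst P)) g f"
  by (auto simp: galg_pair_cat_def case_prod_unfold)

lemma is_category_galg_pair_cat: "is_category (galg_pair_cat :: ('h galg \<times> 'h set, 'h \<Rightarrow> 'h) cat)"
  unfolding is_category_def
proof (intro conjI ballI, goal_cases)
  case (1 P)
  then have "(\<lambda>x\<in>carrier (fst P). x) ` snd P = snd P"
    using graded_subalgebra_subset[of "snd P" "fst P"] by (force simp: galg_pair_cat_simps)
  then show ?case using 1 by (simp add: galg_pair_cat_simps galg_hom_id)
next
  case (2 P Q R f g)
  then have "compose (carrier (fst P)) g f ` snd P = g ` f ` snd P"
    using graded_subalgebra_subset[of "snd P" "fst P"] by (force simp: compose_def galg_pair_cat_simps)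
  moreover have "g ` f ` snd P \<subseteq> snd R"
    using 2 by (auto simp: galg_pair_cat_simps)
  ultimately show ?case
    using 2 galg_hom_compose[of "fst P" f "fst Q" g "fst R"] by (simp add: galg_pair_cat_simps)
next
  case (3 P Q f)
  then show ?case
    using compose_restrict_id(1)[OF galg_hom_PiE, of f "fst P" "fst Q"] by (simp add: galg_pair_cat_simps)
next
  case (4 P Q f)
  then show ?case
    using compose_restrict_id(2)[OF galg_hom_PiE, of f "fst P" "fst Q"] by (simp add: galg_pair_cat_simps)
next
  case (5 P Q R T f g h)
  then show ?case unfolding galg_pair_cat_simps by (intro compose_assoc[OF galg_hom_funcset]) simp
qed

section \<open>The category of graphs\<close>

lemma graph_cat_simps:
  "cat_ob graph_cat = Collect finite_simple_graph" "cat_hom graph_cat = graph_hom"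
  "cat_id graph_cat G = (\<lambda>v\<in>verts G. v)" "cat_comp graph_cat F G K g f = compose (verts F) g f"
  by (auto simp: graph_cat_def)

lemma edge_subset: "finite_simple_graph G \<Longrightarrow> e \<in> edges G \<Longrightarrow> e \<subseteq> verts G"
  by (simp add: finite_simple_graph_def)

lemma graph_hom_PiE: "f \<in> graph_hom F G \<Longrightarrow> f \<in> verts F \<rightarrow>\<^sub>E verts G"
  by (simp add: graph_hom_def)

lemma graph_hom_funcset: "f \<in> graph_hom F G \<Longrightarrow> f \<in> verts F \<rightarrow> verts G"
  using graph_hom_PiE by (auto simp: PiE_def)

lemma graph_hom_edge: "f \<in> graph_hom F G \<Longrightarrow> e \<in> edges F \<Longrightarrow> f ` e \<in> edges G"
  by (simp add: graph_hom_def)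

lemma graph_hom_compose:
  assumes "finite_simple_graph F" "f \<in> graph_hom F G" "g \<in> graph_hom G K"
  shows "compose (verts F) g f \<in> graph_hom F K"
proof -
  have "compose (verts F) g f ` e = g ` f ` e" if "e \<in> edges F" for e
    using edge_subset[OF assms(1) that] by (force simp: compose_def)
  then show ?thesis
    using assms by (auto simp: graph_hom_def compose_def)
qed

lemma graph_hom_id:
  assumes "finite_simple_graph G"
  shows "(\<lambda>v\<in>verts G. v) \<in> graph_hom G G"
proof -
  have "(\<lambda>v\<in>verts G. v) ` e = e" if "e \<in> edges G" for e
    using edge_subset[OF assms that] by force
  then show ?thesis by (simp add: graph_hom_def)
qed

lemma is_category_graph_cat: "is_category (graph_cat :: ('a sgraph, 'a \<Rightarrow> 'a) cat)"
  unfolding is_category_def graph_cat_simps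
  by (auto simp: graph_hom_id compose_restrict_id[OF graph_hom_PiE]
      intro: compose_assoc[OF graph_hom_funcset] graph_hom_compose)

text \<open>Replacing a pair by its distinguished subalgebra is itself functorial, so the second
  functor of the theorem follows formally from the first.\<close>

lemma covariant_functor_restrict:
  assumes "covariant_functor C galg_pair_cat Fo Fm"
  shows "covariant_functor C galg_cat (\<lambda>X. restrict_galg (fst (Fo X)) (snd (Fo X)))
    (\<lambda>X Y f. restrict (Fm X Y f) (snd (Fo X)))"
proof -
  have C: "is_category C"
    and ob: "\<And>X. X \<in> cat_ob C \<Longrightarrow> graded_algebra (fst (Fo X)) \<and> graded_subalgebra (snd (Fo X)) (fst (Fo X))"
    and hom: "\<And>X Y f. X \<in> cat_ob C \<Longrightarrow> Y \<in> cat_ob C \<Longrightarrow> f \<in> cat_hom C X Y \<Longrightarrow>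
      Fm X Y f \<in> galg_hom (fst (Fo X)) (fst (Fo Y)) \<and> Fm X Y f ` snd (Fo X) \<subseteq> snd (Fo Y)"
    and id: "\<And>X. X \<in> cat_ob C \<Longrightarrow> Fm X X (cat_id C X) = (\<lambda>x\<in>carrier (fst (Fo X)). x)"
    and comp: "\<And>X Y Z f g. X \<in> cat_ob C \<Longrightarrow> Y \<in> cat_ob C \<Longrightarrow> Z \<in> cat_ob C \<Longrightarrow>
      f \<in> cat_hom C X Y \<Longrightarrow> g \<in> cat_hom C Y Z \<Longrightarrow>
      Fm X Z (cat_comp C X Y Z g f) = compose (carrier (fst (Fo X))) (Fm Y Z g) (Fm X Y f)"
    using assms by (auto simp: covariant_functor_def galg_pair_cat_simps)
  have sub: "x \<in> carrier (fst (Fo X))" if "X \<in> cat_ob C" "x \<in> snd (Fo X)" for X x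
    using that ob graded_subalgebra_subset by blast
  show ?thesis
    unfolding covariant_functor_def
  proof (intro conjI ballI)
    fix X assume X: "X \<in> cat_ob C"
    then show "restrict_galg (fst (Fo X)) (snd (Fo X)) \<in> cat_ob galg_cat"
      using ob by (simp add: galg_cat_def graded_algebra_restrict_galg)
    show "restrict (Fm X X (cat_id C X)) (snd (Fo X)) =
        cat_id galg_cat (restrict_galg (fst (Fo X)) (snd (Fo X)))"
      using X sub by (auto simp: id galg_cat_def)
    fix Y f assume Y: "Y \<in> cat_ob C" and f: "f \<in> cat_hom C X Y"
    show "restrict (Fm X Y f) (snd (Fo X)) \<in> cat_hom galg_cat
        (restrict_galg (fst (Fo X)) (snd (Fo X))) (restrict_galg (fst (Fo Y)) (snd (Fo Y)))"
      using hom[OF X Y f] ob[OF X] by (simp add: galg_cat_def galg_hom_restrict)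
    fix Z g assume Z: "Z \<in> cat_ob C" and g: "g \<in> cat_hom C Y Z"
    show "restrict (Fm X Z (cat_comp C X Y Z g f)) (snd (Fo X)) = cat_comp galg_cat
        (restrict_galg (fst (Fo X)) (snd (Fo X))) (restrict_galg (fst (Fo Y)) (snd (Fo Y)))
        (restrict_galg (fst (Fo Z)) (snd (Fo Z)))
        (restrict (Fm Y Z g) (snd (Fo Y))) (restrict (Fm X Y f) (snd (Fo X)))"
    proof -
      \<comment> \<open>Without this, the outer restricted map would return \<open>undefined\<close>
        in the composite.\<close>
      have "Fm X Y f x \<in> snd (Fo Y)" if "x \<in> snd (Fo X)" for x
        using hom[OF X Y f] that by blast
      then show ?thesis
        using sub[OF X] by (auto simp: comp[OF X Y Z f g] galg_cat_def compose_def restrict_def intro!: ext)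
    qed
  qed (simp_all add: C is_category_galg_cat)
qed

section \<open>Continuity of the edge planes\<close>

lemma cscale_apply: "cscale c v i = c * v i"
  by (simp add: cscale_def)

lemma quotient_map_quotient_topology: "quotient_map X (quotient_topology X f) f"
  by (auto simp: quotient_map_def topspace_quotient_topology openin_quotient_topology)

lemma quotient_map_frames: "quotient_map (frames k n) (Gr k n) (\<lambda>v. cfun.span (v ` {..<k}))"
  unfolding Gr_def by (rule quotient_map_quotient_topology)

lemma quotient_map_lines: "quotient_map (frames 1 n) (projective_space n) (\<lambda>v. cfun.span {v 0})"
  using quotient_map_frames[of 1 n] by (simp add: projective_space_def lessThan_Suc)

lemma continuous_map_Cspace_component: "continuous_map (Cspace n) euclidean (\<lambda>v. v a)"
  unfolding Cspace_def
  by (intro continuous_map_from_subtopology continuous_map_product_projection) simp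

lemma continuous_map_frames_component:
  "i < k \<Longrightarrow> continuous_map (frames k n) (Cspace n) (\<lambda>v. v i)"
  unfolding frames_def
  by (intro continuous_map_from_subtopology continuous_map_product_projection) simp

section \<open>Affine charts of projective space\<close>

lemma frame_1:
  assumes "v \<in> topspace (frames 1 n)"
  shows "v 0 \<in> topspace (Cspace n)" "v 0 \<noteq> 0"
proof -
  show "v 0 \<in> topspace (Cspace n)"
    using assms by (auto simp: frames_def lessThan_Suc)
  have "cfun.independent {v 0}"
    using assms by (simp add: frames_def lessThan_Suc)
  then show "v 0 \<noteq> 0"
    using cfun.dependent_zero[of "{v 0}"] by auto
qed

text \<open>The standard affine chart, on which the homogeneous coordinate \<open>a\<close> does not
  vanish.\<close>

definition chart :: "nat \<Rightarrow> nat \<Rightarrow> (nat \<Rightarrow> complex) set set" where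
  "chart n a = {l \<in> topspace (projective_space n). \<exists>v\<in>l. v a \<noteq> 0}"

lemma chart_subset: "chart n a \<subseteq> topspace (projective_space n)"
  by (auto simp: chart_def)

text \<open>Normalising coordinate \<open>a\<close> to 1 singles out one vector on the line, which
  gives a section of the tautological line bundle over the chart.\<close>

definition chart_vector :: "nat \<Rightarrow> (nat \<Rightarrow> complex) set \<Rightarrow> nat \<Rightarrow> complex" where
  "chart_vector a l = (SOME v. v \<in> l \<and> v a = 1)"

lemma chart_vector_span:
  assumes "v a \<noteq> 0"
  shows "chart_vector a (cfun.span {v}) = cscale (inverse (v a)) v"
  unfolding chart_vector_def
proof (rule some_equality)
  show "cscale (inverse (v a)) v \<in> cfun.span {v} \<and> cscale (inverse (v a)) v a = 1"
  proof
    show "cscale (inverse (v a)) v \<in> cfun.span {v}"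
      by (intro cfun.span_scale cfun.span_base) simp
    show "cscale (inverse (v a)) v a = 1"
      using assms by (simp add: cscale_def)
  qed
next
  fix w assume "w \<in> cfun.span {v} \<and> w a = 1"
  then obtain c where "w = cscale c v" "c * v a = 1"
    by (auto simp: cfun.span_singleton cscale_def)
  then show "w = cscale (inverse (v a)) v"
    using assms by (simp add: field_simps)
qed

lemma in_chart_span_iff:
  assumes "v \<in> topspace (frames 1 n)"
  shows "cfun.span {v 0} \<in> chart n a \<longleftrightarrow> v 0 a \<noteq> 0"
proof -
  have "cfun.span {v 0} \<in> topspace (projective_space n)"
    using quotient_imp_surjective_map[OF quotient_map_lines[of n]] assms by blast
  moreover have "(\<exists>w\<in>cfun.span {v 0}. w a \<noteq> 0) \<longleftrightarrow> v 0 a \<noteq> 0"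
    by (auto simp: cfun.span_singleton cscale_def intro: exI[of _ 1])
  ultimately show ?thesis by (simp add: chart_def)
qed

lemma lineE:
  assumes "l \<in> topspace (projective_space n)"
  obtains v where "v \<in> topspace (frames 1 n)" "l = cfun.span {v 0}"
  using assms quotient_imp_surjective_map[OF quotient_map_lines[of n]] by blast

lemma line_in_chart:
  assumes "l \<in> topspace (projective_space n)"
  shows "\<exists>a. l \<in> chart n a"
proof -
  obtain v where v: "v \<in> topspace (frames 1 n)" "l = cfun.span {v 0}"
    using assms by (rule lineE)
  then obtain a where "v 0 a \<noteq> 0"
    using frame_1(2)[OF v(1)] by (auto simp: fun_eq_iff)
  then show ?thesis
    using v in_chart_span_iff[OF v(1)] by auto
qed

lemma chart_vector:
  assumes "l \<in> chart n a"
  shows "cfun.span {chart_vector a l} = l" "chart_vector a l \<noteq> 0"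
proof -
  have "l \<in> topspace (projective_space n)" using assms by (simp add: chart_def)
  then obtain v where v: "v \<in> topspace (frames 1 n)" "l = cfun.span {v 0}"
    by (rule lineE)
  have a: "v 0 a \<noteq> 0" using assms in_chart_span_iff[OF v(1)] v(2) by simp
  show "cfun.span {chart_vector a l} = l" "chart_vector a l \<noteq> 0"
    using a frame_1(2)[OF v(1)]
    by (simp_all add: v(2) chart_vector_span cfun.span_image_scale[of "{v 0}" "\<lambda>_. inverse (v 0 a)", simplified])
qed

lemma openin_chart: "openin (projective_space n) (chart n a)"
proof -
  have "continuous_map (frames 1 n) euclidean (\<lambda>v. v 0 a)"
    using continuous_map_compose[OF continuous_map_frames_component[of 0 1 n] continuous_map_Cspace_component[of n a]]
    by (simp add: comp_def)
  then have "openin (frames 1 n) {v \<in> topspace (frames 1 n). v 0 a \<in> - {0}}"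
    by (rule openin_continuous_map_preimage[where Y = euclidean and U = "- {0}"]) auto
  moreover have "{v \<in> topspace (frames 1 n). v 0 a \<in> - {0}} =
      {v \<in> topspace (frames 1 n). cfun.span {v 0} \<in> chart n a}"
    using in_chart_span_iff by auto
  ultimately show ?thesis
    using quotient_map_lines[of n] chart_subset[of n a] by (simp add: quotient_map_def)
qed

lemma continuous_map_divide_complex:
  fixes f g :: "'x \<Rightarrow> complex"
  assumes f: "continuous_map X euclidean f" and g: "continuous_map X euclidean g"
    and "\<And>x. x \<in> topspace X \<Longrightarrow> g x \<noteq> 0"
  shows "continuous_map X euclidean (\<lambda>x. inverse (g x) * f x)"
proof -
  have "continuous_map X (top_of_set {z. snd z \<noteq> 0}) (\<lambda>x. (f x, g x))"
    using assms continuous_map_pairedI[OF f g] by (auto simp: continuous_map_in_subtopology)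
  moreover have "continuous_map (top_of_set {z. snd z \<noteq> 0}) euclidean (\<lambda>z. inverse (snd z) * fst z :: complex)"
    by (auto intro!: continuous_intros)
  ultimately show ?thesis
    using continuous_map_compose[of X _ "\<lambda>x. (f x, g x)" euclidean "\<lambda>z. inverse (snd z) * fst z"]
    by (simp add: comp_def)
qed

text \<open>Restricted to the preimage of an open set, a quotient map remains one. Continuity may
  therefore be tested on frames, where the section is the spanning vector divided by its coordinate
  \<open>a\<close>.\<close>

lemma continuous_map_chart_vector:
  "continuous_map (subtopology (projective_space n) (chart n a)) (Cspace n) (chart_vector a)"
proof (rule continuous_compose_quotient_map)
  let ?U = "{v \<in> topspace (frames 1 n). cfun.span {v 0} \<in> chart n a}"
  let ?X = "subtopology (frames 1 n) ?U"
  show "quotient_map ?X (subtopology (projective_space n) (chart n a)) (\<lambda>v. cfun.span {v 0})"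
    using quotient_map_lines[of n] openin_chart by (intro quotient_map_restriction) auto
  have nz: "v 0 a \<noteq> 0" if "v \<in> topspace ?X" for v
    using that in_chart_span_iff by auto
  have v0: "continuous_map ?X (Cspace n) (\<lambda>v. v 0)"
    using continuous_map_frames_component[of 0 1 n] by (intro continuous_map_from_subtopology) simp
  have comp: "continuous_map ?X euclidean (\<lambda>v. v 0 i)" for i
    using continuous_map_compose[OF v0 continuous_map_Cspace_component[of n i]] by (simp add: comp_def)
  have "continuous_map ?X (Cspace n) (\<lambda>v. cscale (inverse (v 0 a)) (v 0))"
    unfolding Cspace_def continuous_map_in_subtopology
  proof
    show "continuous_map ?X (product_topology (\<lambda>_. euclidean) UNIV) (\<lambda>v. cscale (inverse (v 0 a)) (v 0))"
      unfolding continuous_map_componentwise_UNIV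
    proof
      fix i
      have "continuous_map ?X euclidean (\<lambda>v. inverse (v 0 a) * v 0 i)"
        using comp[of i] comp[of a] nz by (rule continuous_map_divide_complex)
      then show "continuous_map ?X euclidean (\<lambda>v. cscale (inverse (v 0 a)) (v 0) i)"
        by (rule continuous_map_eq) (rule cscale_apply[symmetric])
    qed
    show "(\<lambda>v. cscale (inverse (v 0 a)) (v 0)) \<in> topspace ?X \<rightarrow> {v. \<forall>i\<ge>n. v i = 0}"
      using continuous_map_image_subset_topspace[OF v0] by (auto simp: cscale_def Cspace_def)
  qed
  then show "continuous_map ?X (Cspace n) (chart_vector a \<circ> (\<lambda>v. cfun.span {v 0}))"
    using nz by (elim continuous_map_eq) (simp add: chart_vector_span)
qed

section \<open>Planes spanned by two lines\<close>

lemma span_Un_span: "cfun.span (cfun.span S \<union> cfun.span T) = cfun.span (S \<union> T)"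
  unfolding cfun.span_eq
  using cfun.span_mono[of S "S \<union> T"] cfun.span_mono[of T "S \<union> T"]
    cfun.span_superset[of S] cfun.span_superset[of T] cfun.span_superset[of "cfun.span S \<union> cfun.span T"]
  by blast

text \<open>Translates the defining condition of a graph configuration, distinct lines at the ends
  of an edge, into the condition defining frames.\<close>

lemma independent_pair:
  assumes "s \<noteq> 0" "t \<noteq> 0" "cfun.span {s} \<noteq> cfun.span {t}"
  shows "s \<noteq> t" "cfun.independent {s, t}"
proof -
  show "s \<noteq> t" using assms(3) by auto
  have "s \<notin> cfun.span {t}"
  proof
    assume "s \<in> cfun.span {t}"
    then obtain c where c: "s = cscale c t" by (auto simp: cfun.span_singleton)
    with assms(1) have "c \<noteq> 0" by auto
    then have "cfun.span {s} = cfun.span {t}"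
      using cfun.span_image_scale[of "{t}" "\<lambda>_. c"] by (simp add: c)
    then show False using assms(3) by simp
  qed
  then show "cfun.independent {s, t}"
    using assms(2) by (simp add: cfun.independent_insert)
qed

lemma continuous_map_edge_plane:
  assumes G: "finite_simple_graph G" and e: "e \<in> edges G"
  shows "continuous_map (proj_conf n G) (Gr 2 n) (edge_plane e)"
proof -
  obtain u w where uw: "e = {u, w}" "u \<in> verts G" "w \<in> verts G"
    using G e by (auto simp: finite_simple_graph_def card_2_iff)
  let ?X = "proj_conf n G"
  \<comment> \<open>The cover by pairs of charts, one for the line at each end of the edge.\<close>
  define U where "U = (\<lambda>(a, b). {x \<in> topspace ?X. x u \<in> chart n a} \<inter> {x \<in> topspace ?X. x w \<in> chart n b})"
  have pr: "continuous_map ?X (projective_space n) (\<lambda>x. x v)" if "v \<in> verts G" for v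
    unfolding graph_conf_def using that
    by (intro continuous_map_from_subtopology continuous_map_product_projection)
  have top: "x v \<in> topspace (projective_space n)" if "x \<in> topspace ?X" "v \<in> verts G" for x v
    using continuous_map_image_subset_topspace[OF pr[OF that(2)]] that(1) by auto
  have ne: "x u \<noteq> x w" if "x \<in> topspace ?X" for x
    using that e uw by (auto simp: graph_conf_def)
  show ?thesis
  \<comment> \<open>All pieces carry the same function, so the overlap condition is trivial and only
    local continuity remains.\<close>
  proof (rule pasting_lemma[where I = UNIV and T = U and f = "\<lambda>_. edge_plane e"])
    fix i show "openin ?X (U i)"
      unfolding U_def using uw openin_chart
      by (cases i) (auto intro!: openin_Int openin_continuous_map_preimage[OF pr])
    obtain a b where i: "i = (a, b)" by (cases i)
    \<comment> \<open>The local lift to frames; it is extensional because frames are points of a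
      product over \<open>{..<2}\<close>.\<close>
    define F where "F x = (\<lambda>j\<in>{..<2::nat}. if j = 0 then chart_vector a (x u) else chart_vector b (x w))" for x
    let ?Y = "subtopology ?X (U i)"
    have chart: "x \<in> topspace ?X" "x u \<in> chart n a" "x w \<in> chart n b" if "x \<in> topspace ?Y" for x
      using that by (auto simp: U_def i)
    have F_image: "F x ` {..<2} = {chart_vector a (x u), chart_vector b (x w)}" for x
      by (auto simp: F_def numeral_2_eq_2 lessThan_Suc)
    have cont: "continuous_map ?Y (Cspace n) (\<lambda>x. chart_vector c (x v))"
      if "v \<in> verts G" "\<And>x. x \<in> topspace ?Y \<Longrightarrow> x v \<in> chart n c" for c v
    proof -
      have "continuous_map ?Y (subtopology (projective_space n) (chart n c)) (\<lambda>x. x v)"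
        using that pr[OF that(1)]
        by (auto simp: continuous_map_in_subtopology continuous_map_from_subtopology)
      then show ?thesis
        using continuous_map_compose[OF _ continuous_map_chart_vector] by (fastforce simp: comp_def)
    qed
    have "continuous_map ?Y (frames 2 n) F"
      unfolding frames_def continuous_map_in_subtopology
    proof
      show "continuous_map ?Y (product_topology (\<lambda>_. Cspace n) {..<2}) F"
        unfolding continuous_map_componentwise
      proof (intro conjI ballI)
        fix j :: nat assume "j \<in> {..<2}"
        then show "continuous_map ?Y (Cspace n) (\<lambda>x. F x j)"
          using cont[of u a] cont[of w b] chart uw by (cases "j = 0") (auto simp: F_def)
      qed (auto simp: F_def)
      show "F \<in> topspace ?Y \<rightarrow> {v. inj_on v {..<2} \<and> cfun.independent (v ` {..<2})}"
      proof
        fix x assume x: "x \<in> topspace ?Y"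
        have "chart_vector a (x u) \<noteq> chart_vector b (x w)"
          "cfun.independent {chart_vector a (x u), chart_vector b (x w)}"
          using independent_pair[of "chart_vector a (x u)" "chart_vector b (x w)"]
            chart[OF x] chart_vector ne by metis+
        moreover have "F x 0 = chart_vector a (x u)" "F x 1 = chart_vector b (x w)"
          by (auto simp: F_def)
        ultimately show "F x \<in> {v. inj_on v {..<2} \<and> cfun.independent (v ` {..<2})}"
          unfolding mem_Collect_eq F_image by (auto simp: numeral_2_eq_2 lessThan_Suc)
      qed
    qed
    then have "continuous_map ?Y (Gr 2 n) ((\<lambda>v. cfun.span (v ` {..<2})) \<circ> F)"
      using quotient_imp_continuous_map[OF quotient_map_frames] by (rule continuous_map_compose)
    then show "continuous_map ?Y (Gr 2 n) (edge_plane e)"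
    proof (rule continuous_map_eq)
      fix x assume x: "x \<in> topspace ?Y"
      have "cfun.span {chart_vector a (x u), chart_vector b (x w)} = cfun.span (x u \<union> x w)"
        using span_Un_span[of "{chart_vector a (x u)}" "{chart_vector b (x w)}"]
          chart[OF x] by (simp add: chart_vector(1) insert_commute)
      then show "((\<lambda>v. cfun.span (v ` {..<2})) \<circ> F) x = edge_plane e x"
        unfolding comp_def F_image by (simp add: edge_plane_def uw)
    qed
  next
    fix x assume x: "x \<in> topspace ?X"
    obtain a b where "x u \<in> chart n a" "x w \<in> chart n b"
      using line_in_chart top[OF x] uw by meson
    then show "\<exists>i. i \<in> UNIV \<and> x \<in> U i \<and> edge_plane e x = edge_plane e x"
      using x by (intro exI[of _ "(a, b)"]) (simp add: U_def)
  qed simp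
qed

section \<open>Functoriality of edge-span algebras\<close>

text \<open>Both branches of the definition land in the cohomology of the base: a unique family has
  its member \<open>i\<close> in degree \<open>2 * i\<close>, and the default is the zero
  class.\<close>

lemma chern_class_in_carrier: "chern_class r E i \<in> carrier (coh (base E))"
proof (cases "\<exists>!c. is_chern_classes r E c")
  case True
  have "c i \<in> grade (coh (base E)) (2 * i)" if "is_chern_classes r E c" for c
    using that by (simp add: is_chern_classes_def)
  from this[OF theI'[OF True]] have "chern_class r E i \<in> grade (coh (base E)) (2 * i)"
    unfolding chern_class_def if_P[OF True] .
  then show ?thesis
    using graded_algebraD(6)[OF graded_algebra_coh] by blast
next
  case False
  then show ?thesis by (simp add: chern_class_def zero_coh)
qed

lemma taut_chern_class_in_carrier:
  "chern_class 2 (dual_bundle (taut_bundle 2 n)) i \<in> carrier (coh (Gr 2 n))"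
  using chern_class_in_carrier[of 2 "dual_bundle (taut_bundle 2 n)" i]
  by (simp add: dual_bundle_def taut_bundle_def)

lemma edge_class_in_carrier:
  assumes "finite_simple_graph G" "e \<in> edges G"
  shows "edge_class i n G e \<in> carrier (conf_coh n G)"
  unfolding edge_class_def conf_coh_def
  by (intro coh_map_in_carrier continuous_map_edge_plane taut_chern_class_in_carrier assms)

section \<open>Functoriality of graph configuration spaces\<close>

lemma continuous_map_conf_map:
  assumes F: "finite_simple_graph F" and f: "f \<in> graph_hom F G"
  shows "continuous_map (graph_conf G X) (graph_conf F X) (conf_map F f)"
proof -
  have fv: "f v \<in> verts G" if "v \<in> verts F" for v
    using that graph_hom_funcset[OF f] by blast
  have "continuous_map (graph_conf G X) (product_topology (\<lambda>_. X) (verts F)) (conf_map F f)"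
    unfolding continuous_map_componentwise
  proof (intro conjI ballI)
    fix v assume v: "v \<in> verts F"
    have "continuous_map (graph_conf G X) X (\<lambda>x. x (f v))"
      unfolding graph_conf_def
      by (intro continuous_map_from_subtopology continuous_map_product_projection fv[OF v])
    then show "continuous_map (graph_conf G X) X (\<lambda>x. conf_map F f x v)"
      using v by (simp add: conf_map_def)
  qed (auto simp: conf_map_def)
  moreover have "conf_map F f x u \<noteq> conf_map F f x v"
    if x: "x \<in> topspace (graph_conf G X)" and e: "{u, v} \<in> edges F" for x u v
  proof -
    have "{f u, f v} \<in> edges G" "u \<in> verts F" "v \<in> verts F"
      using graph_hom_edge[OF f e] edge_subset[OF F e] by auto
    then show ?thesis
      using x by (auto simp: conf_map_def graph_conf_def)
  qed
  ultimately show ?thesis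
    unfolding graph_conf_def[of F] continuous_map_in_subtopology by blast
qed

lemma conf_map_id:
  assumes "x \<in> topspace (graph_conf G X)"
  shows "conf_map G (\<lambda>v\<in>verts G. v) x = x"
  using assms by (auto simp: graph_conf_def conf_map_def PiE_def extensional_def fun_eq_iff)

text \<open>Pulling tuples back reverses the order of composition, and cohomology reverses it again;
  the result is covariant in the graph.\<close>

lemma conf_map_compose:
  assumes "f \<in> graph_hom F G"
  shows "conf_map F (compose (verts F) g f) x = conf_map F f (conf_map G g x)"
  using graph_hom_funcset[OF assms] by (auto simp: conf_map_def compose_def fun_eq_iff)

lemma edge_plane_conf_map:
  assumes "finite_simple_graph F" "e \<in> edges F"
  shows "edge_plane e (conf_map F f x) = edge_plane (f ` e) x"
proof -
  have "conf_map F f x v = x (f v)" if "v \<in> e" for v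
    using that edge_subset[OF assms] by (auto simp: conf_map_def)
  then show ?thesis by (simp add: edge_plane_def)
qed

lemma conf_coh_map_in_galg_hom:
  "finite_simple_graph F \<Longrightarrow> f \<in> graph_hom F G \<Longrightarrow>
    conf_coh_map n F G f \<in> galg_hom (conf_coh n F) (conf_coh n G)"
  unfolding conf_coh_def conf_coh_map_def
  by (intro coh_map_in_galg_hom continuous_map_conf_map)

lemma conf_coh_map_edge_class:
  assumes F: "finite_simple_graph F" and f: "f \<in> graph_hom F G" and e: "e \<in> edges F"
  shows "conf_coh_map n F G f (edge_class i n F e) = edge_class i n G (f ` e)"
proof -
  \<comment> \<open>An edge lies within the vertex set, so this is an equality of total functions.
    The same class of the Grassmannian is then pulled back along both sides.\<close>
  have "edge_plane e \<circ> conf_map F f = edge_plane (f ` e)"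
    by (intro ext) (simp add: edge_plane_conf_map[OF F e])
  then have "coh_map (proj_conf n G) (Gr 2 n) (edge_plane (f ` e)) =
    compose (carrier (coh (Gr 2 n))) (conf_coh_map n F G f)
      (coh_map (proj_conf n F) (Gr 2 n) (edge_plane e))"
    using coh_map_compose[OF continuous_map_conf_map[OF F f] continuous_map_edge_plane[OF F e, of n]]
    by (simp add: conf_coh_map_def)
  then show ?thesis
    using taut_chern_class_in_carrier by (simp add: edge_class_def compose_def)
qed

lemma graded_subalgebra_edge_span:
  assumes "finite_simple_graph G"
  shows "graded_subalgebra (edge_span n G) (conf_coh n G)"
  unfolding edge_span_def
  using edge_class_in_carrier[OF assms]
  by (intro graded_subalgebra_generated) (auto simp: conf_coh_def graded_algebra_coh)

lemma conf_coh_map_edge_span: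
  assumes F: "finite_simple_graph F" and G: "finite_simple_graph G" and f: "f \<in> graph_hom F G"
  shows "conf_coh_map n F G f ` edge_span n F \<subseteq> edge_span n G"
  unfolding edge_span_def
proof (rule galg_hom_generated)
  let ?X = "\<lambda>G. \<Union>e\<in>edges G. {edge_class 1 n G e, edge_class 2 n G e}"
  have "conf_coh_map n F G f ` ?X F \<subseteq> ?X G"
    unfolding image_UN
  proof (rule UN_least)
    fix e assume e: "e \<in> edges F"
    have "conf_coh_map n F G f ` {edge_class 1 n F e, edge_class 2 n F e} =
        {edge_class 1 n G (f ` e), edge_class 2 n G (f ` e)}"
      by (simp add: conf_coh_map_edge_class[OF F f e])
    also have "\<dots> \<subseteq> ?X G"
      using graph_hom_edge[OF f e] by (rule UN_upper)
    finally show "conf_coh_map n F G f ` {edge_class 1 n F e, edge_class 2 n F e} \<subseteq> ?X G" .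
  qed
  then show "conf_coh_map n F G f ` ?X F \<subseteq> generated_galg (conf_coh n G) (?X G)"
    using generated_galg_superset by (rule subset_trans)
  show "?X F \<subseteq> carrier (conf_coh n F)" "?X G \<subseteq> carrier (conf_coh n G)"
    by (simp_all add: UN_subset_iff edge_class_in_carrier F G)
  show "graded_algebra (conf_coh n F)" "graded_algebra (conf_coh n G)"
    by (simp_all add: conf_coh_def graded_algebra_coh)
  show "conf_coh_map n F G f \<in> galg_hom (conf_coh n F) (conf_coh n G)"
    using F f by (rule conf_coh_map_in_galg_hom)
qed

lemma covariant_functor_conf_coh:
  "covariant_functor (graph_cat :: ('a sgraph, 'a \<Rightarrow> 'a) cat) galg_pair_cat
     (\<lambda>G. (conf_coh n G, edge_span n G)) (\<lambda>F G f. conf_coh_map n F G f)"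
  unfolding covariant_functor_def
proof (intro conjI ballI)
  fix F :: "'a sgraph" assume "F \<in> cat_ob graph_cat"
  then have F: "finite_simple_graph F" by (simp add: graph_cat_simps)
  show "(conf_coh n F, edge_span n F) \<in> cat_ob galg_pair_cat"
    using graded_subalgebra_edge_span[OF F]
    by (simp add: galg_pair_cat_simps conf_coh_def graded_algebra_coh)
  show "conf_coh_map n F F (cat_id graph_cat F) = cat_id galg_pair_cat (conf_coh n F, edge_span n F)"
    using coh_map_id[OF conf_map_id[of _ F "projective_space n"]]
    by (simp add: graph_cat_simps galg_pair_cat_simps conf_coh_map_def conf_coh_def)
  fix G :: "'a sgraph" and f assume "G \<in> cat_ob graph_cat" "f \<in> cat_hom graph_cat F G"
  then have G: "finite_simple_graph G" and f: "f \<in> graph_hom F G" by (simp_all add: graph_cat_simps)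
  show "conf_coh_map n F G f \<in>
      cat_hom galg_pair_cat (conf_coh n F, edge_span n F) (conf_coh n G, edge_span n G)"
    by (simp add: galg_pair_cat_simps conf_coh_map_in_galg_hom F G f conf_coh_map_edge_span)
  fix K :: "'a sgraph" and g assume "K \<in> cat_ob graph_cat" "g \<in> cat_hom graph_cat G K"
  then have K: "finite_simple_graph K" and g: "g \<in> graph_hom G K" by (simp_all add: graph_cat_simps)
  have "conf_map F (compose (verts F) g f) =
      conf_map F f \<circ> (conf_map G g :: ('a \<Rightarrow> (nat \<Rightarrow> complex) set) \<Rightarrow> _)"
    by (simp add: fun_eq_iff conf_map_compose[OF f])
  then show "conf_coh_map n F K (cat_comp graph_cat F G K g f) =
      cat_comp galg_pair_cat (conf_coh n F, edge_span n F) (conf_coh n G, edge_span n G)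
        (conf_coh n K, edge_span n K) (conf_coh_map n G K g) (conf_coh_map n F G f)"
    using coh_map_compose[OF continuous_map_conf_map[OF G g] continuous_map_conf_map[OF F f],
        of "projective_space n"]
    by (simp add: graph_cat_simps galg_pair_cat_simps conf_coh_map_def conf_coh_def)
qed (simp_all add: is_category_graph_cat is_category_galg_pair_cat)

theorem theorem4p1:
  fixes n :: nat
  assumes "2 \<le> n"
  shows "covariant_functor (graph_cat :: ('a sgraph, 'a \<Rightarrow> 'a) cat) galg_pair_cat
           (\<lambda>G. (conf_coh n G, edge_span n G))
           (\<lambda>F G f. conf_coh_map n F G f)
       \<and> covariant_functor (graph_cat :: ('a sgraph, 'a \<Rightarrow> 'a) cat) galg_cat
           (\<lambda>G. restrict_galg (conf_coh n G) (edge_span n G))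
           (\<lambda>F G f. restrict (conf_coh_map n F G f) (edge_span n F))"
  using covariant_functor_restrict[OF covariant_functor_conf_coh[where 'a = 'a, of n]]
  by (simp add: covariant_functor_conf_coh)

end
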